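(* Let $k$ be an algebraically closed field, let $n\geq 4$, and let $\Gamma$ be a set of $n+3$ distinct points in general linear position in $\mathbb{P}^n_k$. Let $J\subset R=k[x_0,\ldots,x_n]$ be the homogeneous defining ideal of $\Gamma$, let $\Theta$ be the Jacobian matrix of a minimal set of homogeneous generators of $J$, and let $I=(J,I_n(\Theta))$ be the Jacobian ideal of $J$, where $I_n(\Theta)$ is the ideal generated by the $n\times n$ minors of $\Theta$. Then the pair $J\subset I$ is Aluffi torsion-free.
   Context: $R=k[x_0,\ldots,x_n]$ is the standard graded polynomial ring. The defining ideal of a finite set of points $\Gamma\subset\mathbb{P}^n_k$ is $J=\bigcap_{p\in\Gamma} I(p)$, where $I(p)$ is the homogeneous prime ideal of $p$. A set of $s$ distinct points of $\mathbb{P}^n$ is in general linear position if either $s\leq n$ and the points span a $\mathbb{P}^{s-1}$, or $s\geq n+1$ and no subset of $n+1$ of the points is contained in a hyperplane of $\mathbb{P}^n$. A pair of ideals $J\subset I$ of $R$ is called Aluffi torsion-free if its Valabrega--Valla module $\bigoplus_{t\geq 2}\frac{J\cap I^t}{JI^{t-1}}$ is zero, i.e. if $J\cap I^t=JI^{t-1}$ for every $t\geq 2$. *)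

theory Defs
  imports
    "HOL-Library.Poly_Mapping"
    "HOL-Computational_Algebra.Polynomial"
    "HOL-Algebra.Ideal_Product"
    "Jordan_Normal_Form.Determinant"
    "Jordan_Normal_Form.VS_Connect"
    "Jordan_Normal_Form.DL_Submatrix"
begin

section \<open>Polynomials in \<open>x\<^sub>0, \<dots>, x\<^sub>n\<close>\<close>

text \<open>
  The type below is the polynomial ring in countably many variables indexed by \<open>nat\<close>: a monomial is
  a finitely supported exponent function, and the product is that of the monoid algebra.
  The ring \<open>k[x\<^sub>0, \<dots>, x\<^sub>n]\<close> is its subring of polynomials involving only the variables
  with index at most \<open>n\<close>.
\<close>

type_synonym 'k mpoly = "(nat \<Rightarrow>\<^sub>0 nat) \<Rightarrow>\<^sub>0 'k"

definition poly_ring :: "nat \<Rightarrow> 'k::comm_ring_1 mpoly ring" where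
  "poly_ring n =
    class_ring \<lparr> carrier := {f. \<forall>m \<in> Poly_Mapping.keys f. Poly_Mapping.keys m \<subseteq> {..n}} \<rparr>"

definition homogeneous :: "'k::zero mpoly \<Rightarrow> bool" where
  "homogeneous f \<longleftrightarrow>
    (\<exists>d. \<forall>m \<in> Poly_Mapping.keys f. (\<Sum>i \<in> Poly_Mapping.keys m. Poly_Mapping.lookup m i) = d)"

definition mpoly_eval :: "'k::comm_semiring_1 mpoly \<Rightarrow> 'k vec \<Rightarrow> 'k" where
  "mpoly_eval f v =
    (\<Sum>m \<in> Poly_Mapping.keys f.
      Poly_Mapping.lookup f m * (\<Prod>i \<in> Poly_Mapping.keys m. (v $ i) ^ Poly_Mapping.lookup m i))"

text \<open>
  In the formal partial derivative, the subtraction of exponents is truncated, but the monomials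
  in which \<open>x\<^sub>j\<close> does not occur get the coefficient 0.
\<close>

definition mpoly_deriv :: "nat \<Rightarrow> 'k::comm_semiring_1 mpoly \<Rightarrow> 'k mpoly" where
  "mpoly_deriv j f =
    (\<Sum>m \<in> Poly_Mapping.keys f.
      Poly_Mapping.single (m - Poly_Mapping.single j 1)
        (of_nat (Poly_Mapping.lookup m j) * Poly_Mapping.lookup f m))"


section \<open>Points of projective space\<close>

text \<open>
  A point of \<open>\<P>\<^sup>n\<close> is the set of all its vectors of homogeneous coordinates.
\<close>

definition proj_rel :: "nat \<Rightarrow> ('k::field vec \<times> 'k vec) set" where
  "proj_rel n = {(u, v). u \<in> carrier_vec (n + 1) - {0\<^sub>v (n + 1)} \<and>
                         v \<in> carrier_vec (n + 1) - {0\<^sub>v (n + 1)} \<and>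
                         (\<exists>c. c \<noteq> 0 \<and> v = c \<cdot>\<^sub>v u)}"

definition proj_space :: "nat \<Rightarrow> 'k::field vec set set" where
  "proj_space n = (carrier_vec (n + 1) - {0\<^sub>v (n + 1)}) // proj_rel n"

definition is_hyperplane :: "nat \<Rightarrow> 'k::field vec set set \<Rightarrow> bool" where
  "is_hyperplane n H \<longleftrightarrow>
    (\<exists>a \<in> carrier_vec (n + 1) - {0\<^sub>v (n + 1)}. H = {p \<in> proj_space n. \<forall>v \<in> p. a \<bullet> v = 0})"

text \<open>
  A set of points spans a \<open>\<P>\<^sup>s\<^sup>-\<^sup>1\<close> if its vectors of homogeneous coordinates span a
  linear subspace of dimension \<open>s\<close>.
\<close>

definition span_dim :: "nat \<Rightarrow> 'k::field vec set set \<Rightarrow> nat" where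
  "span_dim n \<Gamma> =
    vectorspace.dim class_ring
      (LinearCombinations.module.span_vs class_ring (module_vec TYPE('k) (n + 1)) (\<Union>\<Gamma>))"

definition general_linear_position :: "nat \<Rightarrow> 'k::field vec set set \<Rightarrow> bool" where
  "general_linear_position n \<Gamma> \<longleftrightarrow>
    finite \<Gamma> \<and> \<Gamma> \<subseteq> proj_space n \<and>
    ((card \<Gamma> \<le> n \<and> span_dim n \<Gamma> = card \<Gamma>) \<or>
     (card \<Gamma> \<ge> n + 1 \<and>
      (\<forall>S \<subseteq> \<Gamma>. card S = n + 1 \<longrightarrow> \<not> (\<exists>H. is_hyperplane n H \<and> S \<subseteq> H))))"


section \<open>The defining ideal and the Jacobian ideal\<close>

definition point_ideal :: "nat \<Rightarrow> 'k::field vec set \<Rightarrow> 'k mpoly set" where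
  "point_ideal n p =
    Idl\<^bsub>poly_ring n\<^esub> {f \<in> carrier (poly_ring n). homogeneous f \<and> (\<forall>v \<in> p. mpoly_eval f v = 0)}"

text \<open>
  The intersection with the carrier only matters for the empty set of points.
\<close>

definition defining_ideal :: "nat \<Rightarrow> 'k::field vec set set \<Rightarrow> 'k mpoly set" where
  "defining_ideal n \<Gamma> = carrier (poly_ring n) \<inter> (\<Inter>p \<in> \<Gamma>. point_ideal n p)"

definition minimal_homogeneous_generators ::
    "nat \<Rightarrow> 'k::comm_ring_1 mpoly set \<Rightarrow> 'k mpoly list \<Rightarrow> bool" where
  "minimal_homogeneous_generators n J gs \<longleftrightarrow>
    distinct gs \<and> set gs \<subseteq> carrier (poly_ring n) \<and> (\<forall>g \<in> set gs. homogeneous g) \<and>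
    Idl\<^bsub>poly_ring n\<^esub> (set gs) = J \<and>
    (\<forall>H. H \<subset> set gs \<longrightarrow> Idl\<^bsub>poly_ring n\<^esub> H \<noteq> J)"

definition jacobian_matrix :: "nat \<Rightarrow> 'k::comm_ring_1 mpoly list \<Rightarrow> 'k mpoly mat" where
  "jacobian_matrix n gs = mat (length gs) (n + 1) (\<lambda>(i, j). mpoly_deriv j (gs ! i))"

definition minors_ideal :: "nat \<Rightarrow> nat \<Rightarrow> 'k::comm_ring_1 mpoly mat \<Rightarrow> 'k mpoly set" where
  "minors_ideal n r A =
    Idl\<^bsub>poly_ring n\<^esub> {det (submatrix A I J) | I J.
      I \<subseteq> {..<dim_row A} \<and> card I = r \<and> J \<subseteq> {..<dim_col A} \<and> card J = r}"

definition jacobian_ideal :: "nat \<Rightarrow> 'k::comm_ring_1 mpoly list \<Rightarrow> 'k mpoly set" where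
  "jacobian_ideal n gs =
    Idl\<^bsub>poly_ring n\<^esub> (Idl\<^bsub>poly_ring n\<^esub> (set gs) \<union> minors_ideal n n (jacobian_matrix n gs))"


section \<open>Aluffi torsion-free pairs\<close>

text \<open>
  Powers of ideals are taken in the semiring of ideals, whose multiplication is the ideal product.
\<close>

definition aluffi_torsion_free :: "('a, 'b) ring_scheme \<Rightarrow> 'a set \<Rightarrow> 'a set \<Rightarrow> bool" where
  "aluffi_torsion_free R J I \<longleftrightarrow>
    ideal J R \<and> ideal I R \<and> J \<subseteq> I \<and>
    (\<forall>t::nat. t \<ge> 2 \<longrightarrow>
      J \<inter> (I [^]\<^bsub>ideals_set R\<^esub> t) = ideal_prod R J (I [^]\<^bsub>ideals_set R\<^esub> (t - 1)))"

end

theory Submission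
  imports Defs
begin

text \<open>
Throughout, \<open>J\<close> is the ideal of the points, \<open>I\<close> the Jacobian ideal, and \<open>\<mm>\<^sup>d\<close> stands for the
polynomials all of whose monomials have degree at least \<open>d\<close> (\<open>order_ge n d\<close>).
The statement follows from two facts:

  (1) \<open>I = J + \<mm>\<^sup>n\<close>, and
  (2) \<open>J \<inter> \<mm>\<^sup>n\<^sup>+\<^sup>e \<subseteq> J \<mm>\<^sup>e\<close>.

Indeed (1) gives \<open>I\<^sup>t \<subseteq> J I\<^sup>t\<^sup>-\<^sup>1 + \<mm>\<^sup>n\<^sup>t\<close> by induction on \<open>t\<close> (\<open>I_power_subset\<close>). So an element of
\<open>J \<inter> I\<^sup>t\<close> lies, up to an element of \<open>J I\<^sup>t\<^sup>-\<^sup>1\<close>, in \<open>J \<inter> \<mm>\<^sup>n\<^sup>t\<close>. By (2) that is contained in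
\<open>J \<mm>\<^sup>n\<^sup>(\<^sup>t\<^sup>-\<^sup>1\<^sup>)\<close>, which is contained in \<open>J I\<^sup>t\<^sup>-\<^sup>1\<close> because \<open>\<mm>\<^sup>n \<subseteq> I\<close>.

Fact (2) says that \<open>J\<close> is generated in low degree: a form of degree \<open>d + 1\<close> in \<open>J\<close>, with \<open>d \<ge> 3\<close>,
is \<open>\<Sum> x\<^sub>i F\<^sub>i\<close> with \<open>F\<^sub>i \<in> J\<close> (\<open>J_forms_split\<close>). Starting from any \<open>F\<^sub>i\<close>, their values at the
points are corrected by Koszul syzygies, weighted with forms of degree \<open>d - 1\<close> that vanish at all
points but one.

In (1), the inclusion \<open>I \<subseteq> J + \<mm>\<^sup>n\<close> holds because the points span the space: \<open>J\<close> has no nonzero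
linear forms, so the entries of the Jacobian matrix have order at least 1. For \<open>\<mm>\<^sup>n \<subseteq> I\<close> it is enough to
find for each point \<open>q\<close> a form of degree \<open>n\<close> in \<open>I\<close> that vanishes at all points except \<open>q\<close>, since a
form of degree \<open>n\<close> then differs from a combination of these \<open>n + 3\<close> forms by an element of \<open>J\<close>
(\<open>forms_in_I\<close>).

Let \<open>q, p\<^sub>1, p\<^sub>2, s\<^sub>1, \<dots>, s\<^sub>n\<close> be the points. Let \<open>l\<close> vanish at all \<open>s\<^sub>j\<close>, let \<open>X\<^sub>i\<close> vanish at \<open>q\<close> and at
the \<open>s\<^sub>j\<close> with \<open>j \<noteq> i\<close>, and let \<open>Y\<^sub>i\<close> vanish at \<open>s\<^sub>i, p\<^sub>1, p\<^sub>2\<close> but not at \<open>q\<close>; this is possible by general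
position. Then \<open>Q\<^sub>i = X\<^sub>i Y\<^sub>i\<close> is in \<open>J\<close>, and the wanted form is the determinant \<open>D\<close> whose rows are the
gradients of \<open>Q\<^sub>1, \<dots>, Q\<^sub>n\<close> and the coefficient vector of \<open>l\<close> (\<open>separating_jacobian_determinant\<close>):
\<^item> at \<open>q\<close> the rows are multiples of the coordinate system \<open>X\<^sub>1, \<dots>, X\<^sub>n, l\<close>, so \<open>D \<noteq> 0\<close>;
\<^item> at \<open>s\<^sub>k\<close> all rows annihilate \<open>s\<^sub>k\<close>, by Euler's relation, so \<open>D = 0\<close>;
\<^item> at \<open>p\<^sub>1\<close> and \<open>p\<^sub>2\<close> the gradients are multiples of the \<open>Y\<^sub>i\<close>, which annihilate both \<open>p\<^sub>1\<close> and \<open>p\<^sub>2\<close>.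
  Some nonzero vector of their span is annihilated by \<open>l\<close> as well, so \<open>D = 0\<close>.

Expanding \<open>D\<close> along its last row gives a combination of maximal minors of the gradients of elements
of \<open>J\<close>. These lie in \<open>I\<close> although the \<open>Q\<^sub>i\<close> need not be among the chosen generators
(\<open>jacobian_minor_of_ideal_elements\<close>).
\<close>

section \<open>Monomials\<close>

definition monomial_degree :: "(nat \<Rightarrow>\<^sub>0 nat) \<Rightarrow> nat" where
  "monomial_degree m = (\<Sum>i\<in>Poly_Mapping.keys m. Poly_Mapping.lookup m i)"

definition monomial_value :: "'k::comm_semiring_1 vec \<Rightarrow> (nat \<Rightarrow>\<^sub>0 nat) \<Rightarrow> 'k" where
  "monomial_value v m = (\<Prod>i\<in>Poly_Mapping.keys m. (v $ i) ^ Poly_Mapping.lookup m i)"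

lemma monomial_degree_superset:
  assumes "finite A" "Poly_Mapping.keys m \<subseteq> A"
  shows "monomial_degree m = (\<Sum>i\<in>A. Poly_Mapping.lookup m i)"
  unfolding monomial_degree_def
  by (rule sum.mono_neutral_left) (use assms in \<open>auto simp: in_keys_iff\<close>)

lemma monomial_value_superset:
  assumes "finite A" "Poly_Mapping.keys m \<subseteq> A"
  shows "monomial_value v m = (\<Prod>i\<in>A. (v $ i) ^ Poly_Mapping.lookup m i)"
  unfolding monomial_value_def
  by (rule prod.mono_neutral_left) (use assms in \<open>auto simp: in_keys_iff\<close>)

lemma keys_add_nat:
  fixes m m' :: "nat \<Rightarrow>\<^sub>0 nat"
  shows "Poly_Mapping.keys (m + m') = Poly_Mapping.keys m \<union> Poly_Mapping.keys m'"
  by (auto simp: in_keys_iff lookup_add)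

lemma monomial_degree_add: "monomial_degree (m + m') = monomial_degree m + monomial_degree m'"
proof -
  let ?A = "Poly_Mapping.keys m \<union> Poly_Mapping.keys m'"
  show ?thesis
    by (subst (1 2 3) monomial_degree_superset[of ?A])
       (auto simp: keys_add_nat lookup_add sum.distrib)
qed

lemma monomial_value_add: "monomial_value v (m + m') = monomial_value v m * monomial_value v m'"
proof -
  let ?A = "Poly_Mapping.keys m \<union> Poly_Mapping.keys m'"
  show ?thesis
    by (subst (1 2 3) monomial_value_superset[of ?A])
       (auto simp: keys_add_nat lookup_add prod.distrib power_add)
qed

lemma monomial_degree_0 [simp]: "monomial_degree 0 = 0"
  and monomial_value_0 [simp]: "monomial_value v 0 = 1"
  and monomial_degree_single [simp]: "monomial_degree (Poly_Mapping.single i c) = c"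
  and monomial_value_single [simp]: "monomial_value v (Poly_Mapping.single i c) = (v $ i) ^ c"
  by (auto simp: monomial_degree_def monomial_value_def)

lemma monomial_degree_eq_0: "monomial_degree m = 0 \<longleftrightarrow> m = 0"
  by (auto simp: monomial_degree_def in_keys_iff intro!: poly_mapping_eqI)

lemma monomial_split_variable:
  fixes m :: "nat \<Rightarrow>\<^sub>0 nat"
  assumes "i \<in> Poly_Mapping.keys m"
  shows "m = Poly_Mapping.single i 1 + (m - Poly_Mapping.single i 1)"
  using assms by (intro poly_mapping_eqI) (auto simp: lookup_add lookup_minus lookup_single in_keys_iff when_def)

text \<open>
  A monomial of degree at least \<open>a\<close> has a divisor of degree exactly \<open>a\<close>: strip off variables one by one.
\<close>

lemma monomial_split_degree:
  assumes "a \<le> monomial_degree m"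
  shows "\<exists>m1 m2. m = m1 + m2 \<and> monomial_degree m1 = a"
  using assms
proof (induction a)
  case 0
  show ?case by (rule exI[of _ 0], rule exI[of _ m]) simp
next
  case (Suc a)
  then obtain m1 m2 where m: "m = m1 + m2" "monomial_degree m1 = a" by auto
  with Suc.prems have "m2 \<noteq> 0" by (auto simp: monomial_degree_add)
  then obtain i where "i \<in> Poly_Mapping.keys m2"
    by (metis all_not_in_conv keys_eq_empty)
  from monomial_split_variable[OF this]
  have "m = (m1 + Poly_Mapping.single i 1) + (m2 - Poly_Mapping.single i 1)"
    using m by (simp add: add.assoc)
  then show ?case using m by (metis monomial_degree_add monomial_degree_single Suc_eq_plus1)
qed

section \<open>Evaluation and differentiation\<close>

lemma poly_as_sum_of_monomials:
  fixes f :: "'k::comm_monoid_add mpoly"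
  shows "f = (\<Sum>m\<in>Poly_Mapping.keys f. Poly_Mapping.single m (Poly_Mapping.lookup f m))"
  by (rule poly_mapping_eqI)
     (auto simp: lookup_sum lookup_single when_def not_in_keys_iff_lookup_eq_zero sum.If_cases Int_def
       cong: if_cong)

text \<open>
  An additive property of a polynomial only needs to be checked on its monomials. This reduces the
  product rules for evaluation and differentiation to single monomials, and membership in an ideal
  to the membership of monomials.
\<close>

lemma poly_monomial_induct:
  fixes f :: "'k::comm_monoid_add mpoly"
  assumes "\<And>m c. m \<in> Poly_Mapping.keys f \<Longrightarrow> c \<noteq> 0 \<Longrightarrow> Q (Poly_Mapping.single m c)"
    and "Q 0" and "\<And>a b. Q a \<Longrightarrow> Q b \<Longrightarrow> Q (a + b)"
  shows "Q f"
proof -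
  have "Q (\<Sum>m\<in>A. Poly_Mapping.single m (Poly_Mapping.lookup f m))"
    if "finite A" "A \<subseteq> Poly_Mapping.keys f" for A
    using that by (induction) (auto intro!: assms simp: in_keys_iff)
  from this[of "Poly_Mapping.keys f"] show ?thesis
    using poly_as_sum_of_monomials[of f] by simp
qed

lemma mpoly_eval_alt:
  "mpoly_eval f v = (\<Sum>m\<in>Poly_Mapping.keys f. Poly_Mapping.lookup f m * monomial_value v m)"
  by (simp add: mpoly_eval_def monomial_value_def)

lemma mpoly_eval_0 [simp]: "mpoly_eval 0 v = 0"
  and mpoly_eval_single: "mpoly_eval (Poly_Mapping.single m c) v = c * monomial_value v m"
  by (auto simp: mpoly_eval_alt)

lemma mpoly_eval_add: "mpoly_eval (f + g) v = mpoly_eval f v + mpoly_eval g v"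
  unfolding mpoly_eval_alt
  by (rule setsum_keys_plus_distrib) (auto simp: algebra_simps)

lemma mpoly_eval_mult:
  fixes f g :: "'k::comm_ring_1 mpoly"
  shows "mpoly_eval (f * g) v = mpoly_eval f v * mpoly_eval g v"
proof (rule poly_monomial_induct[of f])
  fix m and c :: 'k
  show "mpoly_eval (Poly_Mapping.single m c * g) v = mpoly_eval (Poly_Mapping.single m c) v * mpoly_eval g v"
  proof (rule poly_monomial_induct[of g])
    fix m' and c' :: 'k
    show "mpoly_eval (Poly_Mapping.single m c * Poly_Mapping.single m' c') v =
      mpoly_eval (Poly_Mapping.single m c) v * mpoly_eval (Poly_Mapping.single m' c') v"
      by (simp add: mult_single mpoly_eval_single monomial_value_add)
  qed (auto simp: algebra_simps mpoly_eval_add)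
qed (auto simp: algebra_simps mpoly_eval_add)

lemma mpoly_eval_1 [simp]: "mpoly_eval 1 v = (1::'k::comm_ring_1)"
  using mpoly_eval_single[of 0 1 v] by simp

lemma mpoly_eval_hom: "comm_ring_hom (\<lambda>f :: 'k::comm_ring_1 mpoly. mpoly_eval f v)"
  by unfold_locales (auto simp: mpoly_eval_add mpoly_eval_mult)

lemma mpoly_deriv_0 [simp]: "mpoly_deriv j 0 = 0"
  and mpoly_deriv_single: "mpoly_deriv j (Poly_Mapping.single m c) =
    Poly_Mapping.single (m - Poly_Mapping.single j 1) (of_nat (Poly_Mapping.lookup m j) * c)"
  by (auto simp: mpoly_deriv_def)

lemma mpoly_deriv_add: "mpoly_deriv j (f + g) = mpoly_deriv j f + mpoly_deriv j g"
  unfolding mpoly_deriv_def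
  by (rule setsum_keys_plus_distrib) (auto simp: algebra_simps single_add)

lemma mpoly_deriv_mult:
  fixes f g :: "'k::comm_ring_1 mpoly"
  shows "mpoly_deriv j (f * g) = mpoly_deriv j f * g + f * mpoly_deriv j g"
proof (rule poly_monomial_induct[of f])
  fix m and c :: 'k
  show "mpoly_deriv j (Poly_Mapping.single m c * g) =
    mpoly_deriv j (Poly_Mapping.single m c) * g + Poly_Mapping.single m c * mpoly_deriv j g"
  proof (rule poly_monomial_induct[of g])
    fix m' and c' :: 'k
    \<comment> \<open>Where the truncated subtraction of exponents is not additive, the coefficient is zero.\<close>
    let ?e = "Poly_Mapping.single j (1::nat)"
    have shift: "a + b - ?e = (a - ?e) + b" if "Poly_Mapping.lookup a j \<noteq> 0" for a b :: "nat \<Rightarrow>\<^sub>0 nat"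
      using that by (intro poly_mapping_eqI) (auto simp: lookup_add lookup_minus lookup_single when_def)
    have 1: "Poly_Mapping.single (m - ?e + m') (of_nat (Poly_Mapping.lookup m j) * c * c') =
        Poly_Mapping.single (m + m' - ?e) (of_nat (Poly_Mapping.lookup m j) * c * c')"
      using shift[of m m'] by (cases "Poly_Mapping.lookup m j = 0") auto
    have 2: "Poly_Mapping.single (m + (m' - ?e)) (c * (of_nat (Poly_Mapping.lookup m' j) * c')) =
        Poly_Mapping.single (m + m' - ?e) (c * (of_nat (Poly_Mapping.lookup m' j) * c'))"
      using shift[of m' m] by (cases "Poly_Mapping.lookup m' j = 0") (auto simp: add.commute)
    show "mpoly_deriv j (Poly_Mapping.single m c * Poly_Mapping.single m' c') =
      mpoly_deriv j (Poly_Mapping.single m c) * Poly_Mapping.single m' c' +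
      Poly_Mapping.single m c * mpoly_deriv j (Poly_Mapping.single m' c')"
      unfolding mpoly_deriv_single mult_single 1 2
      by (simp add: single_add[symmetric] lookup_add algebra_simps)
  qed (auto simp: algebra_simps mpoly_deriv_add)
qed (auto simp: algebra_simps mpoly_deriv_add)

section \<open>Ideals of the polynomial ring\<close>

lemma poly_ring_simps [simp]:
  "f \<otimes>\<^bsub>poly_ring n\<^esub> g = f * g" "f \<oplus>\<^bsub>poly_ring n\<^esub> g = f + g"
  "\<one>\<^bsub>poly_ring n\<^esub> = 1" "\<zero>\<^bsub>poly_ring n\<^esub> = 0"
  by (auto simp: poly_ring_def)

lemma carrier_poly_ring: "carrier (poly_ring n) = {f. \<forall>m\<in>Poly_Mapping.keys f. Poly_Mapping.keys m \<subseteq> {..n}}"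
  by (simp add: poly_ring_def)

lemma poly_ring_closed [intro, simp]:
  fixes f g :: "'k::comm_ring_1 mpoly"
  shows "0 \<in> carrier (poly_ring n)" "(1::'k mpoly) \<in> carrier (poly_ring n)"
    "f \<in> carrier (poly_ring n) \<Longrightarrow> g \<in> carrier (poly_ring n) \<Longrightarrow> f + g \<in> carrier (poly_ring n)"
    "f \<in> carrier (poly_ring n) \<Longrightarrow> g \<in> carrier (poly_ring n) \<Longrightarrow> f * g \<in> carrier (poly_ring n)"
    "f \<in> carrier (poly_ring n) \<Longrightarrow> - f \<in> carrier (poly_ring n)"
    "f \<in> carrier (poly_ring n) \<Longrightarrow> g \<in> carrier (poly_ring n) \<Longrightarrow> f - g \<in> carrier (poly_ring n)"
proof -
  show add: "f \<in> carrier (poly_ring n) \<Longrightarrow> g \<in> carrier (poly_ring n) \<Longrightarrow> f + g \<in> carrier (poly_ring n)" for f g :: "'k mpoly"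
    using keys_add[of f g] by (fastforce simp: carrier_poly_ring)
  show "f \<in> carrier (poly_ring n) \<Longrightarrow> g \<in> carrier (poly_ring n) \<Longrightarrow> f * g \<in> carrier (poly_ring n)"
    using keys_mult[of f g] by (fastforce simp: carrier_poly_ring keys_add_nat)
  show neg: "f \<in> carrier (poly_ring n) \<Longrightarrow> - f \<in> carrier (poly_ring n)" for f :: "'k mpoly"
    by (auto simp: carrier_poly_ring in_keys_iff)
  show "f \<in> carrier (poly_ring n) \<Longrightarrow> g \<in> carrier (poly_ring n) \<Longrightarrow> f - g \<in> carrier (poly_ring n)"
    using add[of f "-g"] neg[of g] by simp
qed (auto simp: carrier_poly_ring)

lemma cring_poly_ring: "cring (poly_ring n :: 'k::comm_ring_1 mpoly ring)"
proof (rule cringI)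
  show "abelian_group (poly_ring n :: 'k mpoly ring)"
    by (rule abelian_groupI) (auto simp: algebra_simps intro!: bexI[of _ "- _"])
  show "comm_monoid (poly_ring n :: 'k mpoly ring)"
    by (rule comm_monoidI) (auto simp: algebra_simps)
qed (auto simp: algebra_simps)

lemma poly_ring_a_inv: "f \<in> carrier (poly_ring n) \<Longrightarrow> \<ominus>\<^bsub>poly_ring n\<^esub> f = - (f :: 'k::comm_ring_1 mpoly)"
proof -
  interpret cring "poly_ring n :: 'k mpoly ring" by (rule cring_poly_ring)
  assume "f \<in> carrier (poly_ring n)"
  then show ?thesis using minus_equality[of "-f" f] by simp
qed

lemma ideal_poly_ringI:
  assumes "J \<subseteq> carrier (poly_ring n)" "0 \<in> J" "\<And>f g. f \<in> J \<Longrightarrow> g \<in> J \<Longrightarrow> f + g \<in> J"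
    and "\<And>h f. h \<in> carrier (poly_ring n) \<Longrightarrow> f \<in> J \<Longrightarrow> h * f \<in> J"
  shows "ideal (J :: 'k::comm_ring_1 mpoly set) (poly_ring n)"
proof -
  interpret cring "poly_ring n :: 'k mpoly ring" by (rule cring_poly_ring)
  show ?thesis
  proof (rule idealI)
    show "ring (poly_ring n :: 'k mpoly ring)" by (rule ring_axioms)
    show "subgroup J (add_monoid (poly_ring n))"
    proof (rule add.subgroupI)
      fix f assume f: "f \<in> J"
      then have "\<ominus>\<^bsub>poly_ring n\<^esub> f = (-1) * f" using poly_ring_a_inv assms(1) by auto
      then show "\<ominus>\<^bsub>poly_ring n\<^esub> f \<in> J" using assms(4)[of "-1" f] f by simp
    qed (use assms in auto)
  next
    fix f h :: "'k mpoly" assume "f \<in> J" "h \<in> carrier (poly_ring n)"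
    then have "h * f \<in> J" by (rule assms(4)[rotated])
    then show "h \<otimes>\<^bsub>poly_ring n\<^esub> f \<in> J" "f \<otimes>\<^bsub>poly_ring n\<^esub> h \<in> J"
      by (simp_all add: mult.commute)
  qed
qed

lemma
  fixes J :: "'k::comm_ring_1 mpoly set"
  assumes "ideal J (poly_ring n)"
  shows poly_ideal_carrier: "f \<in> J \<Longrightarrow> f \<in> carrier (poly_ring n)"
    and poly_ideal_0: "0 \<in> J"
    and poly_ideal_add: "f \<in> J \<Longrightarrow> g \<in> J \<Longrightarrow> f + g \<in> J"
    and poly_ideal_mult: "h \<in> carrier (poly_ring n) \<Longrightarrow> f \<in> J \<Longrightarrow> h * f \<in> J"
    and poly_ideal_mult': "h \<in> carrier (poly_ring n) \<Longrightarrow> f \<in> J \<Longrightarrow> f * h \<in> J"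
    and poly_ideal_diff: "f \<in> J \<Longrightarrow> g \<in> J \<Longrightarrow> f - g \<in> J"
    and poly_ideal_sum: "(\<And>x. x \<in> A \<Longrightarrow> F x \<in> J) \<Longrightarrow> (\<Sum>x\<in>A. F x) \<in> J"
proof -
  interpret ideal J "poly_ring n" by fact
  show car: "f \<in> J \<Longrightarrow> f \<in> carrier (poly_ring n)" for f using Icarr by simp
  show zero: "0 \<in> J" using additive_subgroup.zero_closed[OF ideal.axioms(1)[OF assms]] by simp
  show add: "f \<in> J \<Longrightarrow> g \<in> J \<Longrightarrow> f + g \<in> J" for f g
    using additive_subgroup.a_closed[OF ideal.axioms(1)[OF assms], of f g] by simp
  show mult: "h \<in> carrier (poly_ring n) \<Longrightarrow> f \<in> J \<Longrightarrow> h * f \<in> J" for h f using I_l_closed by simp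
  show "h \<in> carrier (poly_ring n) \<Longrightarrow> f \<in> J \<Longrightarrow> f * h \<in> J" using I_r_closed by simp
  show "f \<in> J \<Longrightarrow> g \<in> J \<Longrightarrow> f - g \<in> J" using add[of f "(-1) * g"] mult[of "-1" g] by simp
  show "(\<And>x. x \<in> A \<Longrightarrow> F x \<in> J) \<Longrightarrow> (\<Sum>x\<in>A. F x) \<in> J"
    by (induction A rule: infinite_finite_induct) (auto intro: add zero)
qed

lemma genideal_poly_ring_ideal:
  "S \<subseteq> carrier (poly_ring n) \<Longrightarrow> ideal (Idl\<^bsub>poly_ring n\<^esub> S) (poly_ring n :: 'k::comm_ring_1 mpoly ring)"
  using ring.genideal_ideal[OF cring.axioms(1)[OF cring_poly_ring]] by blast

lemma genideal_poly_ring_self: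
  "S \<subseteq> carrier (poly_ring n) \<Longrightarrow> (S :: 'k::comm_ring_1 mpoly set) \<subseteq> Idl\<^bsub>poly_ring n\<^esub> S"
  using ring.genideal_self[OF cring.axioms(1)[OF cring_poly_ring]] by blast

lemma genideal_poly_ring_minimal:
  "ideal J (poly_ring n) \<Longrightarrow> S \<subseteq> J \<Longrightarrow> Idl\<^bsub>poly_ring n\<^esub> (S :: 'k::comm_ring_1 mpoly set) \<subseteq> J"
  using ring.genideal_minimal[OF cring.axioms(1)[OF cring_poly_ring]] by blast

lemma one_ideals_set [simp]: "\<one>\<^bsub>ideals_set R\<^esub> = carrier R"
  by (simp add: ideals_set_def)

lemma ideals_set_pow_0: "I [^]\<^bsub>ideals_set R\<^esub> (0::nat) = carrier R"
  and ideals_set_pow_Suc: "I [^]\<^bsub>ideals_set R\<^esub> Suc t = ideal_prod R (I [^]\<^bsub>ideals_set R\<^esub> t) I"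
  by (simp_all add: nat_pow_def ideals_set_def)

lemma ideal_prod_poly_ring_ideal:
  "ideal I (poly_ring n) \<Longrightarrow> ideal J (poly_ring n) \<Longrightarrow>
    ideal (ideal_prod (poly_ring n) I J) (poly_ring n :: 'k::comm_ring_1 mpoly ring)"
  using ring.ideal_prod_is_ideal[OF cring.axioms(1)[OF cring_poly_ring]] by blast

lemma ideals_set_pow_ideal:
  "ideal I (poly_ring n) \<Longrightarrow>
    ideal (I [^]\<^bsub>ideals_set (poly_ring n)\<^esub> (t::nat)) (poly_ring n :: 'k::comm_ring_1 mpoly ring)"
proof (induction t)
  case 0
  then show ?case
    using ring.oneideal[OF cring.axioms(1)[OF cring_poly_ring]] by (simp add: ideals_set_pow_0)
next
  case (Suc t)
  then show ?case unfolding ideals_set_pow_Suc by (simp add: ideal_prod_poly_ring_ideal)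
qed

lemma ideal_prod_mult_mem:
  fixes f g :: "'k::comm_ring_1 mpoly"
  shows "f \<in> I \<Longrightarrow> g \<in> J \<Longrightarrow> f * g \<in> ideal_prod (poly_ring n) I J"
  using ideal_prod.prod[of f I g J "poly_ring n"] by simp

lemma ideal_prod_least:
  fixes K :: "'k::comm_ring_1 mpoly set"
  assumes "ideal K (poly_ring n)" "\<And>f g. f \<in> I \<Longrightarrow> g \<in> J \<Longrightarrow> f * g \<in> K"
  shows "ideal_prod (poly_ring n) I J \<subseteq> K"
proof
  fix x assume "x \<in> ideal_prod (poly_ring n) I J"
  then show "x \<in> K"
    by induction (use assms poly_ideal_add[OF assms(1)] in auto)
qed

lemma ideal_prod_mult_right:
  fixes h :: "'k::comm_ring_1 mpoly"
  assumes "x \<in> ideal_prod (poly_ring n) I J" "\<And>g. g \<in> J \<Longrightarrow> h * g \<in> J'"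
  shows "h * x \<in> ideal_prod (poly_ring n) I J'"
  using assms(1)
proof induction
  case (prod f g)
  have "f * (h * g) \<in> ideal_prod (poly_ring n) I J'"
    by (intro ideal_prod_mult_mem prod assms)
  then show ?case by (simp add: ac_simps)
next
  case (sum x y)
  have "h * x + h * y \<in> ideal_prod (poly_ring n) I J'"
    using ideal_prod.sum[OF sum.IH] by simp
  then show ?case by (simp add: distrib_left)
qed

lemma ideal_prod_mono_right:
  fixes J J' :: "'k::comm_ring_1 mpoly set"
  assumes "J \<subseteq> J'"
  shows "ideal_prod (poly_ring n) I J \<subseteq> ideal_prod (poly_ring n) I J'"
proof
  fix x assume "x \<in> ideal_prod (poly_ring n) I J"
  then show "x \<in> ideal_prod (poly_ring n) I J'"
    using ideal_prod_mult_right[of x n I J 1 J'] assms by auto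
qed

lemma sum_of_ideals_ideal:
  fixes A B :: "'k::comm_ring_1 mpoly set"
  assumes A: "ideal A (poly_ring n)" and B: "ideal B (poly_ring n)"
  shows "ideal {a + b | a b. a \<in> A \<and> b \<in> B} (poly_ring n)"
proof (rule ideal_poly_ringI)
  show "{a + b | a b. a \<in> A \<and> b \<in> B} \<subseteq> carrier (poly_ring n)"
    using poly_ideal_carrier[OF A] poly_ideal_carrier[OF B] by auto
  show "0 \<in> {a + b | a b. a \<in> A \<and> b \<in> B}"
    using poly_ideal_0[OF A] poly_ideal_0[OF B] by force
  fix f g assume "f \<in> {a + b | a b. a \<in> A \<and> b \<in> B}" "g \<in> {a + b | a b. a \<in> A \<and> b \<in> B}"
  then obtain a b a' b' where *: "a \<in> A" "b \<in> B" "f = a + b" "a' \<in> A" "b' \<in> B" "g = a' + b'" by auto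
  then have "f + g = (a + a') + (b + b')" by (simp add: ac_simps)
  then show "f + g \<in> {a + b | a b. a \<in> A \<and> b \<in> B}"
    using * poly_ideal_add[OF A] poly_ideal_add[OF B] by blast
next
  fix h f :: "'k mpoly" assume h: "h \<in> carrier (poly_ring n)" and "f \<in> {a + b | a b. a \<in> A \<and> b \<in> B}"
  then obtain a b where *: "a \<in> A" "b \<in> B" "f = a + b" by auto
  then have "h * f = h * a + h * b" by (simp add: distrib_left)
  then show "h * f \<in> {a + b | a b. a \<in> A \<and> b \<in> B}"
    using * h poly_ideal_mult[OF A] poly_ideal_mult[OF B] by blast
qed

section \<open>Graded pieces\<close>

definition form_space :: "nat \<Rightarrow> nat \<Rightarrow> 'k::comm_ring_1 mpoly set" where
  "form_space n d = {f \<in> carrier (poly_ring n). \<forall>m\<in>Poly_Mapping.keys f. monomial_degree m = d}"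

text \<open>
  The \<open>d\<close>-th power of the irrelevant ideal, described by its monomials.
\<close>

definition order_ge :: "nat \<Rightarrow> nat \<Rightarrow> 'k::comm_ring_1 mpoly set" where
  "order_ge n d = {f \<in> carrier (poly_ring n). \<forall>m\<in>Poly_Mapping.keys f. d \<le> monomial_degree m}"

definition form_part :: "nat \<Rightarrow> 'k::comm_ring_1 mpoly \<Rightarrow> 'k mpoly" where
  "form_part d f = (\<Sum>m\<in>{m\<in>Poly_Mapping.keys f. monomial_degree m = d}.
     Poly_Mapping.single m (Poly_Mapping.lookup f m))"

lemma form_space_carrier: "f \<in> form_space n d \<Longrightarrow> f \<in> carrier (poly_ring n)"
  by (simp add: form_space_def)

lemma form_space_0 [simp, intro]: "0 \<in> form_space n d"
  by (simp add: form_space_def)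

lemma form_space_1 [simp, intro]: "1 \<in> form_space n 0"
  by (simp add: form_space_def)

lemma form_space_add: "f \<in> form_space n d \<Longrightarrow> g \<in> form_space n d \<Longrightarrow> f + g \<in> form_space n d"
  using keys_add[of f g] by (auto simp: form_space_def)

lemma form_space_mult: "f \<in> form_space n d \<Longrightarrow> g \<in> form_space n e \<Longrightarrow> f * g \<in> form_space n (d + e)"
  using keys_mult[of f g] by (fastforce simp: form_space_def monomial_degree_add)

lemma form_space_uminus: "f \<in> form_space n d \<Longrightarrow> - f \<in> form_space n d"
  by (auto simp: form_space_def in_keys_iff)

lemma form_space_diff: "f \<in> form_space n d \<Longrightarrow> g \<in> form_space n d \<Longrightarrow> f - g \<in> form_space n d"
  using form_space_add[of f n d "-g"] form_space_uminus[of g n d] by simp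

lemma form_space_sum: "(\<And>x. x \<in> A \<Longrightarrow> F x \<in> form_space n d) \<Longrightarrow> (\<Sum>x\<in>A. F x) \<in> form_space n d"
  by (induction A rule: infinite_finite_induct) (auto intro: form_space_add)

lemma form_space_prod: "(\<And>x. x \<in> A \<Longrightarrow> F x \<in> form_space n (d x)) \<Longrightarrow> (\<Prod>x\<in>A. F x) \<in> form_space n (\<Sum>x\<in>A. d x)"
  by (induction A rule: infinite_finite_induct) (auto intro: form_space_mult)

lemma form_space_power: "f \<in> form_space n d \<Longrightarrow> f ^ k \<in> form_space n (k * d)"
  by (induction k) (auto intro: form_space_mult)

lemma form_space_const: "Poly_Mapping.single 0 c \<in> form_space n 0"
  by (auto simp: form_space_def carrier_poly_ring)

lemma form_space_smult: "f \<in> form_space n d \<Longrightarrow> Poly_Mapping.single 0 c * f \<in> form_space n d"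
  using form_space_mult[OF form_space_const, of f n d c] by simp

lemma order_ge_carrier: "f \<in> order_ge n d \<Longrightarrow> f \<in> carrier (poly_ring n)"
  by (simp add: order_ge_def)

lemma order_ge_0_eq: "order_ge n 0 = carrier (poly_ring n)"
  by (auto simp: order_ge_def)

lemma order_ge_mult: "f \<in> order_ge n d \<Longrightarrow> g \<in> order_ge n e \<Longrightarrow> f * g \<in> order_ge n (d + e)"
  using keys_mult[of f g] by (fastforce simp: order_ge_def monomial_degree_add intro: add_mono)

lemma order_ge_ideal: "ideal (order_ge n d :: 'k::comm_ring_1 mpoly set) (poly_ring n)"
proof (rule ideal_poly_ringI)
  fix f g :: "'k mpoly"
  show "f \<in> order_ge n d \<Longrightarrow> g \<in> order_ge n d \<Longrightarrow> f + g \<in> order_ge n d"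
    using keys_add[of f g] by (auto simp: order_ge_def)
  show "g \<in> carrier (poly_ring n) \<Longrightarrow> f \<in> order_ge n d \<Longrightarrow> g * f \<in> order_ge n d"
    using order_ge_mult[of g n 0 f d] by (simp add: order_ge_0_eq)
qed (auto simp: order_ge_def)

lemma form_space_subset_order_ge: "d \<le> e \<Longrightarrow> form_space n e \<subseteq> order_ge n d"
  by (auto simp: form_space_def order_ge_def)

lemma keys_form_part: "Poly_Mapping.keys (form_part d f) = {m\<in>Poly_Mapping.keys f. monomial_degree m = d}"
proof -
  have "Poly_Mapping.lookup (form_part d f) m = (if monomial_degree m = d then Poly_Mapping.lookup f m else 0)" for m
    by (auto simp: form_part_def lookup_sum lookup_single when_def sum.If_cases Int_def in_keys_iff cong: if_cong)
  then show ?thesis by (auto simp: in_keys_iff split: if_splits)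
qed

lemma form_part_in: "f \<in> carrier (poly_ring n) \<Longrightarrow> form_part d f \<in> form_space n d"
  by (auto simp: form_space_def keys_form_part carrier_poly_ring)

lemma poly_as_sum_of_forms:
  "f = (\<Sum>d\<in>monomial_degree ` Poly_Mapping.keys f. form_part d f)"
  by (subst poly_as_sum_of_monomials[of f], subst sum.image_gen[of _ _ monomial_degree])
     (auto simp: form_part_def)

lemma monomial_value_scale:
  assumes "Poly_Mapping.keys m \<subseteq> {..n}" "v \<in> carrier_vec (n + 1)"
  shows "monomial_value (c \<cdot>\<^sub>v v) m = c ^ monomial_degree m * monomial_value v m"
proof -
  have "monomial_value (c \<cdot>\<^sub>v v) m = (\<Prod>i\<in>Poly_Mapping.keys m. (c * v $ i) ^ Poly_Mapping.lookup m i)"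
    unfolding monomial_value_def by (rule prod.cong) (use assms in auto)
  then show ?thesis
    by (simp add: power_mult_distrib prod.distrib monomial_value_def monomial_degree_def power_sum)
qed

lemma form_eval_scale:
  assumes "f \<in> form_space n d" "v \<in> carrier_vec (n + 1)"
  shows "mpoly_eval f (c \<cdot>\<^sub>v v) = c ^ d * mpoly_eval f v"
  using assms unfolding mpoly_eval_alt sum_distrib_left
  by (intro sum.cong) (auto simp: form_space_def carrier_poly_ring monomial_value_scale)

text \<open>
  A monomial of degree at least \<open>d (t + 1)\<close> splits off a monomial of degree \<open>d\<close>, which is in \<open>I\<close>;
  induction on \<open>t\<close> distributes the monomial over \<open>t\<close> factors.
\<close>

lemma order_ge_power:
  fixes I :: "'k::comm_ring_1 mpoly set"
  assumes I: "ideal I (poly_ring n)" and forms: "form_space n d \<subseteq> I"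
  shows "order_ge n (d * t) \<subseteq> I [^]\<^bsub>ideals_set (poly_ring n)\<^esub> t"
proof (induction t)
  case 0
  then show ?case by (simp add: ideals_set_pow_0 order_ge_0_eq)
next
  case (Suc t)
  let ?K = "I [^]\<^bsub>ideals_set (poly_ring n)\<^esub> Suc t"
  have K: "ideal ?K (poly_ring n)" by (rule ideals_set_pow_ideal[OF I])
  show ?case
  proof
    fix f :: "'k mpoly" assume f: "f \<in> order_ge n (d * Suc t)"
    show "f \<in> ?K"
    proof (rule poly_monomial_induct[of f])
      fix m and c :: 'k assume "m \<in> Poly_Mapping.keys f"
      with f have m: "Poly_Mapping.keys m \<subseteq> {..n}" "d * Suc t \<le> monomial_degree m"
        by (auto simp: order_ge_def carrier_poly_ring)
      then obtain m1 m2 where m12: "m = m1 + m2" "monomial_degree m1 = d"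
        using monomial_split_degree[of d m] by auto
      have "Poly_Mapping.single m2 c \<in> order_ge n (d * t)"
        using m m12 by (auto simp: order_ge_def carrier_poly_ring keys_add_nat monomial_degree_add)
      then have 1: "Poly_Mapping.single m2 c \<in> I [^]\<^bsub>ideals_set (poly_ring n)\<^esub> t" using Suc by auto
      have "Poly_Mapping.single m1 1 \<in> form_space n d"
        using m m12 by (auto simp: form_space_def carrier_poly_ring keys_add_nat)
      then have 2: "Poly_Mapping.single m1 1 \<in> I" using forms by auto
      have "Poly_Mapping.single m2 c * Poly_Mapping.single m1 1 \<in> ?K"
        unfolding ideals_set_pow_Suc by (rule ideal_prod_mult_mem[OF 1 2])
      then show "Poly_Mapping.single m c \<in> ?K"
        by (simp add: mult_single m12 add.commute)
    qed (use poly_ideal_0[OF K] poly_ideal_add[OF K] in auto)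
  qed
qed

section \<open>Linear forms and partial derivatives\<close>

abbreviation variable :: "nat \<Rightarrow> 'k::comm_ring_1 mpoly" where
  "variable i \<equiv> Poly_Mapping.single (Poly_Mapping.single i 1) 1"

definition linear_form :: "nat \<Rightarrow> 'k::comm_ring_1 vec \<Rightarrow> 'k mpoly" where
  "linear_form n a = (\<Sum>i\<in>{..n}. Poly_Mapping.single (Poly_Mapping.single i 1) (a $ i))"

lemma single_variable_in: "i \<le> n \<Longrightarrow> Poly_Mapping.single (Poly_Mapping.single i 1) c \<in> form_space n 1"
  by (auto simp: form_space_def carrier_poly_ring)

lemma linear_form_in: "linear_form n a \<in> form_space n 1"
  unfolding linear_form_def by (intro form_space_sum single_variable_in) auto

lemma linear_form_alt: "linear_form n a = (\<Sum>i\<le>n. variable i * Poly_Mapping.single 0 (a $ i))"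
  by (simp add: linear_form_def mult_single)

lemma mpoly_eval_sum: "mpoly_eval (\<Sum>x\<in>A. F x) v = (\<Sum>x\<in>A. mpoly_eval (F x) v)"
  by (induction A rule: infinite_finite_induct) (auto simp: mpoly_eval_add)

lemma mpoly_deriv_sum: "mpoly_deriv j (\<Sum>x\<in>A. F x) = (\<Sum>x\<in>A. mpoly_deriv j (F x))"
  by (induction A rule: infinite_finite_induct) (auto simp: mpoly_deriv_add)

lemma mpoly_eval_linear_form:
  assumes "v \<in> carrier_vec (n + 1)"
  shows "mpoly_eval (linear_form n a) v = a \<bullet> v"
proof -
  have "{..n} = {0..<n + 1}" by auto
  then show ?thesis using assms
    unfolding linear_form_def mpoly_eval_sum mpoly_eval_single scalar_prod_def by simp
qed

lemma mpoly_deriv_linear_form: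
  assumes "j \<le> n"
  shows "mpoly_deriv j (linear_form n a) = Poly_Mapping.single 0 (a $ j)"
proof -
  have "mpoly_deriv j (linear_form n a) =
      (\<Sum>i\<le>n. if i = j then Poly_Mapping.single 0 (a $ j) else 0)"
    unfolding linear_form_def mpoly_deriv_sum mpoly_deriv_single
    by (rule sum.cong) (auto simp: lookup_single when_def)
  then show ?thesis using assms by simp
qed

lemma eval_deriv_linear_product:
  assumes "j \<le> n" "v \<in> carrier_vec (n + 1)"
  shows "mpoly_eval (mpoly_deriv j (linear_form n a * linear_form n b)) v = a $ j * (b \<bullet> v) + (a \<bullet> v) * b $ j"
  using assms
  by (simp add: mpoly_deriv_mult mpoly_eval_add mpoly_eval_mult mpoly_deriv_linear_form
      mpoly_eval_linear_form mpoly_eval_single)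

lemma monomial_degree_1E:
  assumes "monomial_degree m = 1"
  obtains j where "m = Poly_Mapping.single j 1"
proof -
  have "m \<noteq> 0" using assms by auto
  then obtain j where "j \<in> Poly_Mapping.keys m" by (metis all_not_in_conv keys_eq_empty)
  from monomial_split_variable[OF this] obtain m' where m: "m = Poly_Mapping.single j 1 + m'" by blast
  with assms have "m' = 0" by (simp add: monomial_degree_add monomial_degree_eq_0)
  with m that show ?thesis by simp
qed

lemma form_space_1_linear_form:
  assumes "f \<in> form_space n 1"
  shows "f = linear_form n (vec (n + 1) (\<lambda>i. Poly_Mapping.lookup f (Poly_Mapping.single i 1)))"
    (is "_ = linear_form n ?a")
proof (rule poly_mapping_eqI)
  fix m
  have inj: "Poly_Mapping.single i (1::nat) = Poly_Mapping.single j 1 \<longleftrightarrow> i = j" for i j :: nat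
    by (metis lookup_single_eq lookup_single_not_eq zero_neq_one)
  show "Poly_Mapping.lookup f m = Poly_Mapping.lookup (linear_form n ?a) m"
  proof (cases "\<exists>j\<le>n. m = Poly_Mapping.single j 1")
    case True
    then obtain j where j: "j \<le> n" "m = Poly_Mapping.single j 1" by auto
    then have "Poly_Mapping.lookup (linear_form n ?a) m = (\<Sum>i\<le>n. if i = j then ?a $ j else 0)"
      unfolding linear_form_def lookup_sum by (intro sum.cong) (auto simp: lookup_single when_def inj simp del: One_nat_def)
    then show ?thesis using j by simp
  next
    case False
    have "m \<notin> Poly_Mapping.keys f"
    proof
      assume m: "m \<in> Poly_Mapping.keys f"
      with assms have "monomial_degree m = 1" "Poly_Mapping.keys m \<subseteq> {..n}"
        by (auto simp: form_space_def carrier_poly_ring)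
      then obtain j where "m = Poly_Mapping.single j 1" "Poly_Mapping.keys m \<subseteq> {..n}"
        using monomial_degree_1E by blast
      then show False using False by auto
    qed
    moreover have "Poly_Mapping.lookup (linear_form n ?a) m = 0"
      unfolding linear_form_def lookup_sum using False
      by (intro sum.neutral) (auto simp: lookup_single when_def)
    ultimately show ?thesis by (simp add: in_keys_iff)
  qed
qed

text \<open>
  Each monomial is assigned to one variable that divides it.
\<close>

lemma form_split_variables:
  fixes f :: "'k::comm_ring_1 mpoly"
  assumes "f \<in> form_space n (Suc d)"
  shows "\<exists>F. (\<forall>i. F i \<in> form_space n d) \<and> f = (\<Sum>i\<le>n. variable i * F i)"
proof (rule poly_monomial_induct[of f])
  fix m and c :: 'k assume m: "m \<in> Poly_Mapping.keys f" and "c \<noteq> 0"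
  from m assms have deg: "monomial_degree m = Suc d" and car: "Poly_Mapping.keys m \<subseteq> {..n}"
    by (auto simp: form_space_def carrier_poly_ring)
  then have "m \<noteq> 0" by auto
  then obtain j where j: "j \<in> Poly_Mapping.keys m" by (metis all_not_in_conv keys_eq_empty)
  from monomial_split_variable[OF this] obtain m' where m': "m = Poly_Mapping.single j 1 + m'" by blast
  let ?F = "\<lambda>i. if i = j then Poly_Mapping.single m' c else 0"
  have "Poly_Mapping.keys m' \<subseteq> {..n}" "monomial_degree m' = d" "j \<le> n"
    using car deg j by (auto simp: m' keys_add_nat monomial_degree_add)
  then have "\<forall>i. ?F i \<in> form_space n d" by (auto simp: form_space_def carrier_poly_ring)
  moreover have "Poly_Mapping.single m c = (\<Sum>i\<le>n. variable i * ?F i)"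
    using \<open>j \<le> n\<close> by (simp add: if_distrib mult_single m' cong: if_cong)
  ultimately show "\<exists>F. (\<forall>i. F i \<in> form_space n d) \<and> Poly_Mapping.single m c = (\<Sum>i\<le>n. variable i * F i)"
    by (intro exI[of _ ?F] conjI)
next
  fix a b :: "'k mpoly"
  assume "\<exists>F. (\<forall>i. F i \<in> form_space n d) \<and> a = (\<Sum>i\<le>n. variable i * F i)"
    and "\<exists>F. (\<forall>i. F i \<in> form_space n d) \<and> b = (\<Sum>i\<le>n. variable i * F i)"
  then obtain F G where "\<forall>i. F i \<in> form_space n d" "a = (\<Sum>i\<le>n. variable i * F i)"
    "\<forall>i. G i \<in> form_space n d" "b = (\<Sum>i\<le>n. variable i * G i)" by blast
  then show "\<exists>F. (\<forall>i. F i \<in> form_space n d) \<and> a + b = (\<Sum>i\<le>n. variable i * F i)"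
    by (intro exI[of _ "\<lambda>i. F i + G i"]) (auto simp: distrib_left sum.distrib intro: form_space_add)
qed (auto intro!: exI[of _ "\<lambda>_. 0"])

lemma mpoly_deriv_monomial_in:
  assumes "Poly_Mapping.keys m \<subseteq> {..n}" "monomial_degree m = e"
  shows "mpoly_deriv j (Poly_Mapping.single m c) \<in> form_space n (e - 1)"
proof (cases "j \<in> Poly_Mapping.keys m")
  case True
  from monomial_split_variable[OF this] obtain m' where m': "m = Poly_Mapping.single j 1 + m'" by blast
  then show ?thesis using assms
    by (auto simp: mpoly_deriv_single form_space_def carrier_poly_ring keys_add_nat monomial_degree_add)
next
  case False
  then show ?thesis by (simp add: mpoly_deriv_single not_in_keys_iff_lookup_eq_zero)
qed

lemma mpoly_deriv_form:
  fixes f :: "'k::comm_ring_1 mpoly"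
  assumes "f \<in> form_space n (Suc d)"
  shows "mpoly_deriv j f \<in> form_space n d"
proof (rule poly_monomial_induct[of f])
  fix m and c :: 'k assume "m \<in> Poly_Mapping.keys f"
  with assms have "Poly_Mapping.keys m \<subseteq> {..n}" "monomial_degree m = Suc d"
    by (auto simp: form_space_def carrier_poly_ring)
  then show "mpoly_deriv j (Poly_Mapping.single m c) \<in> form_space n d"
    using mpoly_deriv_monomial_in[of m n "Suc d" j c] by simp
qed (auto simp: mpoly_deriv_add intro: form_space_add)

lemma mpoly_deriv_order_ge:
  fixes f :: "'k::comm_ring_1 mpoly"
  assumes "f \<in> order_ge n d"
  shows "mpoly_deriv j f \<in> order_ge n (d - 1)"
proof (rule poly_monomial_induct[of f])
  fix m and c :: 'k assume "m \<in> Poly_Mapping.keys f"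
  with assms have "Poly_Mapping.keys m \<subseteq> {..n}" "d - 1 \<le> monomial_degree m - 1"
    by (auto simp: order_ge_def carrier_poly_ring)
  then show "mpoly_deriv j (Poly_Mapping.single m c) \<in> order_ge n (d - 1)"
    using mpoly_deriv_monomial_in[of m n "monomial_degree m" j c] form_space_subset_order_ge by blast
qed (auto simp: mpoly_deriv_add intro: poly_ideal_add[OF order_ge_ideal] poly_ideal_0[OF order_ge_ideal])

lemma mpoly_deriv_carrier: "f \<in> carrier (poly_ring n) \<Longrightarrow> mpoly_deriv j f \<in> carrier (poly_ring n)"
  using mpoly_deriv_order_ge[of f n 0 j] by (simp add: order_ge_0_eq)

section \<open>Determinants of polynomial matrices\<close>

lemma signof_cases: "signof p = (1::'a::comm_ring_1) \<or> signof p = (-1::'a)"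
  by (auto simp: sign_def)

lemma det_in_form_space:
  fixes A :: "'k::comm_ring_1 mpoly mat"
  assumes A: "A \<in> carrier_mat r r"
    and entries: "\<And>i j. i < r \<Longrightarrow> j < r \<Longrightarrow> A $$ (i, j) \<in> form_space n (d i)"
  shows "det A \<in> form_space n (\<Sum>i<r. d i)"
  unfolding det_def'[OF A]
proof (rule form_space_sum)
  fix p assume "p \<in> {p. p permutes {0..<r}}"
  then have "p i < r" if "i < r" for i using permutes_in_image[of p "{0..<r}" i] that by auto
  then have "(\<Prod>i = 0..<r. A $$ (i, p i)) \<in> form_space n (\<Sum>i = 0..<r. d i)"
    by (intro form_space_prod entries) auto
  then show "signof p * (\<Prod>i = 0..<r. A $$ (i, p i)) \<in> form_space n (\<Sum>i<r. d i)"
    using signof_cases[of p, where 'a="'k mpoly"] form_space_uminus by (auto simp: atLeast0LessThan)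
qed

lemma order_ge_prod:
  "finite A \<Longrightarrow> (\<And>x. x \<in> A \<Longrightarrow> F x \<in> order_ge n e) \<Longrightarrow> (\<Prod>x\<in>A. F x) \<in> order_ge n (card A * e)"
proof (induction A rule: finite_induct)
  case empty
  show ?case by (simp add: order_ge_0_eq)
qed (auto intro: order_ge_mult)

lemma det_in_order_ge:
  fixes A :: "'k::comm_ring_1 mpoly mat"
  assumes A: "A \<in> carrier_mat r r"
    and entries: "\<And>i j. i < r \<Longrightarrow> j < r \<Longrightarrow> A $$ (i, j) \<in> order_ge n e"
  shows "det A \<in> order_ge n (r * e)"
  unfolding det_def'[OF A]
proof (rule poly_ideal_sum[OF order_ge_ideal])
  fix p assume "p \<in> {p. p permutes {0..<r}}"
  then have "p i < r" if "i < r" for i using permutes_in_image[of p "{0..<r}" i] that by auto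
  then have "(\<Prod>i = 0..<r. A $$ (i, p i)) \<in> order_ge n (card {0..<r} * e)"
    by (intro order_ge_prod entries) auto
  moreover have "signof p \<in> carrier (poly_ring n :: 'k mpoly ring)"
    using signof_cases[of p, where 'a="'k mpoly"] by auto
  ultimately show "signof p * (\<Prod>i = 0..<r. A $$ (i, p i)) \<in> order_ge n (r * e)"
    using poly_ideal_mult[OF order_ge_ideal] by auto
qed

lemma det_in_carrier:
  fixes A :: "'k::comm_ring_1 mpoly mat"
  assumes "A \<in> carrier_mat r r" "\<And>i j. i < r \<Longrightarrow> j < r \<Longrightarrow> A $$ (i, j) \<in> carrier (poly_ring n)"
  shows "det A \<in> carrier (poly_ring n)"
  using det_in_order_ge[of A r n 0] assms by (simp add: order_ge_0_eq)

lemma pick_bij_betw: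
  assumes "finite S"
  shows "bij_betw (pick S) {0..<card S} S"
proof -
  have inj: "inj_on (pick S) {0..<card S}"
  proof (rule inj_onI)
    fix x y assume "x \<in> {0..<card S}" "y \<in> {0..<card S}" "pick S x = pick S y"
    then show "x = y" using pick_mono_le[of x S y] pick_mono_le[of y S x]
      by (cases x y rule: linorder_cases) auto
  qed
  moreover have "pick S ` {0..<card S} = S"
    using pick_in_set_le[of _ S] inj assms by (intro card_subset_eq) (auto simp: card_image)
  ultimately show ?thesis by (simp add: bij_betw_def)
qed

text \<open>
  Minors are defined by increasing choices of rows and columns. A choice in any other order differs
  from the increasing one by a permutation, so the minor only changes its sign.
\<close>

lemma det_reindex_rows:
  fixes B :: "nat \<Rightarrow> nat \<Rightarrow> 'a::comm_ring_1"
  assumes "inj_on f {0..<r}"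
  shows "\<exists>p. det (mat r r (\<lambda>(i, j). B (f i) j)) =
    signof p * det (mat r r (\<lambda>(i, j). B (pick (f ` {0..<r}) i) j))"
proof -
  let ?S = "f ` {0..<r}"
  have card: "card ?S = r" using assms by (simp add: card_image)
  have pick: "bij_betw (pick ?S) {0..<r} ?S" using pick_bij_betw[of ?S] card by simp
  define g where "g = the_inv_into {0..<r} (pick ?S) \<circ> f"
  define p where "p i = (if i < r then g i else i)" for i
  have g: "bij_betw g {0..<r} {0..<r}"
    unfolding g_def using assms bij_betw_the_inv_into[OF pick]
    by (intro bij_betw_trans[of f _ ?S]) (auto simp: bij_betw_def)
  have "p permutes {0..<r}"
  proof (rule bij_imp_permutes)
    show "bij_betw p {0..<r} {0..<r}"
      by (rule bij_betw_cong[THEN iffD1, OF _ g]) (auto simp: p_def)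
  qed (auto simp: p_def)
  moreover have p_less: "p i < r" if "i < r" for i
    using that g by (auto simp: p_def bij_betw_def)
  moreover have pick_p: "pick ?S (p i) = f i" if "i < r" for i
    using that pick f_the_inv_into_f[of "pick ?S" "{0..<r}" "f i"] by (auto simp: p_def g_def bij_betw_def)
  let ?A = "mat r r (\<lambda>(i, j). B (pick ?S i) j)"
  have "mat r r (\<lambda>(i, j). B (f i) j) = mat r r (\<lambda>(i, j). ?A $$ (p i, j))"
    by (rule eq_matI) (auto simp: p_less pick_p)
  ultimately show ?thesis using det_permute_rows[of ?A r p] by auto
qed

lemma det_reindex_columns:
  fixes B :: "nat \<Rightarrow> nat \<Rightarrow> 'a::comm_ring_1"
  assumes "inj_on g {0..<r}"
  shows "\<exists>p. det (mat r r (\<lambda>(i, j). B i (g j))) =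
    signof p * det (mat r r (\<lambda>(i, j). B i (pick (g ` {0..<r}) j)))"
proof -
  have transp: "det (mat r r (\<lambda>(i, j). C i j)) = det (mat r r (\<lambda>(i, j). C j i))" for C :: "nat \<Rightarrow> nat \<Rightarrow> 'a"
  proof -
    have "mat r r (\<lambda>(i, j). C j i) = transpose_mat (mat r r (\<lambda>(i, j). C i j))"
      by (rule eq_matI) auto
    then show ?thesis by (simp add: det_transpose[of _ r])
  qed
  from det_reindex_rows[OF assms, of "\<lambda>i j. B j i"] show ?thesis
    by (subst (1 2) transp) simp
qed

lemma det_not_inj_rows:
  fixes B :: "nat \<Rightarrow> nat \<Rightarrow> 'a::comm_ring_1"
  assumes "\<not> inj_on f {0..<r}"
  shows "det (mat r r (\<lambda>(i, j). B (f i) j)) = 0"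
proof -
  from assms obtain i j where "i < r" "j < r" "i \<noteq> j" "f i = f j" by (auto simp: inj_on_def)
  then show ?thesis by (intro det_identical_rows[of _ r i j]) (auto intro!: eq_vecI)
qed

lemma det_not_inj_columns:
  fixes B :: "nat \<Rightarrow> nat \<Rightarrow> 'a::comm_ring_1"
  assumes "\<not> inj_on g {0..<r}"
  shows "det (mat r r (\<lambda>(i, j). B i (g j))) = 0"
proof -
  from assms obtain i j where "i < r" "j < r" "i \<noteq> j" "g i = g j" by (auto simp: inj_on_def)
  then show ?thesis by (intro det_identical_columns[of _ r i j]) (auto intro!: eq_vecI)
qed

lemma submatrix_carrier_of_card:
  assumes "I \<subseteq> {..<dim_row A}" "J \<subseteq> {..<dim_col A}"
  shows "submatrix A I J = mat (card I) (card J) (\<lambda>(i, j). A $$ (pick I i, pick J j))"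
proof -
  have "{i. i < dim_row A \<and> i \<in> I} = I" "{i. i < dim_col A \<and> i \<in> J} = J" using assms by auto
  then show ?thesis by (simp add: submatrix_def)
qed

lemma minors_generators_carrier:
  fixes A :: "'k::comm_ring_1 mpoly mat"
  assumes "\<And>i j. i < dim_row A \<Longrightarrow> j < dim_col A \<Longrightarrow> A $$ (i, j) \<in> order_ge n e"
    and "I \<subseteq> {..<dim_row A}" "card I = r" "J \<subseteq> {..<dim_col A}" "card J = r"
  shows "det (submatrix A I J) \<in> order_ge n (r * e)"
proof (rule det_in_order_ge)
  show "submatrix A I J \<in> carrier_mat r r" using assms by (simp add: submatrix_carrier_of_card)
  fix i j assume ij: "i < r" "j < r"
  then have "pick I i \<in> I" "pick J j \<in> J" using assms pick_in_set_le by auto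
  then show "submatrix A I J $$ (i, j) \<in> order_ge n e"
    using assms ij by (auto simp: submatrix_carrier_of_card)
qed

lemma reindexed_minor_in_minors_ideal:
  fixes A :: "'k::comm_ring_1 mpoly mat"
  assumes entries: "\<And>i j. i < dim_row A \<Longrightarrow> j < dim_col A \<Longrightarrow> A $$ (i, j) \<in> carrier (poly_ring n)"
    and f: "\<And>i. i < r \<Longrightarrow> f i < dim_row A" and g: "\<And>j. j < r \<Longrightarrow> g j < dim_col A"
  shows "det (mat r r (\<lambda>(i, j). A $$ (f i, g j))) \<in> minors_ideal n r A"
proof -
  let ?S = "{det (submatrix A I J) | I J.
      I \<subseteq> {..<dim_row A} \<and> card I = r \<and> J \<subseteq> {..<dim_col A} \<and> card J = r}"
  have S: "?S \<subseteq> carrier (poly_ring n)"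
    using minors_generators_carrier[of A n 0 _ r] entries by (auto simp: order_ge_0_eq)
  have ideal: "ideal (minors_ideal n r A) (poly_ring n)"
    unfolding minors_ideal_def by (rule genideal_poly_ring_ideal[OF S])
  have sub: "?S \<subseteq> minors_ideal n r A"
    unfolding minors_ideal_def by (rule genideal_poly_ring_self[OF S])
  show ?thesis
  proof (cases "inj_on f {0..<r} \<and> inj_on g {0..<r}")
    case True
    let ?I = "f ` {0..<r}" and ?J = "g ` {0..<r}"
    obtain p where p: "det (mat r r (\<lambda>(i, j). A $$ (f i, g j))) =
        signof p * det (mat r r (\<lambda>(i, j). A $$ (pick ?I i, g j)))"
      using det_reindex_rows[of f r "\<lambda>i j. A $$ (i, g j)"] True by blast
    obtain q where q: "det (mat r r (\<lambda>(i, j). A $$ (pick ?I i, g j))) =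
        signof q * det (mat r r (\<lambda>(i, j). A $$ (pick ?I i, pick ?J j)))"
      using det_reindex_columns[of g r "\<lambda>i j. A $$ (pick ?I i, j)"] True by blast
    have card: "card ?I = r" "card ?J = r" using True by (auto simp: card_image)
    have IJ: "?I \<subseteq> {..<dim_row A}" "?J \<subseteq> {..<dim_col A}" using f g by auto
    have "det (mat r r (\<lambda>(i, j). A $$ (pick ?I i, pick ?J j))) = det (submatrix A ?I ?J)"
      using submatrix_carrier_of_card[OF IJ] card by simp
    also have "\<dots> \<in> minors_ideal n r A" using sub IJ card by blast
    finally have mem: "det (mat r r (\<lambda>(i, j). A $$ (pick ?I i, pick ?J j))) \<in> minors_ideal n r A" .
    have sgn: "signof p \<in> carrier (poly_ring n :: 'k mpoly ring)" for p
      using signof_cases[of p, where 'a="'k mpoly"] by auto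
    show ?thesis unfolding p q
      by (intro poly_ideal_mult[OF ideal] sgn mem)
  next
    case False
    then have "det (mat r r (\<lambda>(i, j). A $$ (f i, g j))) = 0"
      using det_not_inj_rows[of f r "\<lambda>i j. A $$ (i, g j)"]
        det_not_inj_columns[of g r "\<lambda>i j. A $$ (f i, j)"] by auto
    then show ?thesis using poly_ideal_0[OF ideal] by simp
  qed
qed

section \<open>Jacobian minors of elements of the ideal\<close>

text \<open>
  The columns may be chosen in any order and with repetitions; the rows are the gradients of arbitrary
  polynomials.
\<close>

definition jacobian_minor :: "nat \<Rightarrow> (nat \<Rightarrow> nat) \<Rightarrow> (nat \<Rightarrow> 'k::comm_ring_1 mpoly) \<Rightarrow> 'k mpoly" where
  "jacobian_minor r g Q = det (mat r r (\<lambda>(i, j). mpoly_deriv (g j) (Q i)))"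

lemma
  fixes a b h :: "'k::comm_ring_1 mpoly"
  assumes "m < r"
  shows jacobian_minor_add: "jacobian_minor r g (Q(m := a + b)) =
      jacobian_minor r g (Q(m := a)) + jacobian_minor r g (Q(m := b))"
    and jacobian_minor_mult: "jacobian_minor r g (Q(m := h * a)) =
      a * jacobian_minor r g (Q(m := h)) + h * jacobian_minor r g (Q(m := a))"
proof -
  define c where "c = (\<lambda>i. vec r (\<lambda>j. mpoly_deriv (g j) (Q i)))"
  define D where "D = (\<lambda>v. det (mat\<^sub>r r r (\<lambda>i. if i = m then v else c i)))"
  have D: "jacobian_minor r g (Q(m := q)) = D (vec r (\<lambda>j. mpoly_deriv (g j) q))" for q
    unfolding jacobian_minor_def D_def
    by (rule arg_cong[of _ _ det], rule eq_matI) (auto simp: c_def)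
  have c: "c \<in> {0..<r} \<rightarrow> carrier_vec r" by (auto simp: c_def)
  have D_add: "D (v + w) = D v + D w" if "v \<in> carrier_vec r" "w \<in> carrier_vec r" for v w
    unfolding D_def using det_row_add[of "\<lambda>_. v" m r "\<lambda>_. w" c] that c assms by simp
  have D_smult: "D (x \<cdot>\<^sub>v v) = x * D v" if v: "v \<in> carrier_vec r" for x v
  proof -
    have "D (x \<cdot>\<^sub>v v) = det (mat\<^sub>r r r (\<lambda>i. (if i = m then x else 1) \<cdot>\<^sub>v (if i = m then v else c i)))"
      unfolding D_def by (rule arg_cong[of _ _ det], rule eq_matI) (use v in \<open>auto simp: c_def\<close>)
    also have "\<dots> = (\<Prod>i\<in>{0..<r}. if i = m then x else 1) * D v"
      unfolding D_def by (rule det_rows_mul) (use v c in auto)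
    finally show ?thesis using assms by simp
  qed
  have "vec r (\<lambda>j. mpoly_deriv (g j) (a + b)) = vec r (\<lambda>j. mpoly_deriv (g j) a) + vec r (\<lambda>j. mpoly_deriv (g j) b)"
    by (rule eq_vecI) (auto simp: mpoly_deriv_add)
  then show "jacobian_minor r g (Q(m := a + b)) =
      jacobian_minor r g (Q(m := a)) + jacobian_minor r g (Q(m := b))"
    unfolding D by (simp add: D_add)
  have "vec r (\<lambda>j. mpoly_deriv (g j) (h * a)) =
      a \<cdot>\<^sub>v vec r (\<lambda>j. mpoly_deriv (g j) h) + h \<cdot>\<^sub>v vec r (\<lambda>j. mpoly_deriv (g j) a)"
    by (rule eq_vecI) (auto simp: mpoly_deriv_mult mult.commute)
  then show "jacobian_minor r g (Q(m := h * a)) =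
      a * jacobian_minor r g (Q(m := h)) + h * jacobian_minor r g (Q(m := a))"
    unfolding D by (simp add: D_add D_smult)
qed

lemma jacobian_minor_in_carrier:
  "(\<And>i. i < r \<Longrightarrow> Q i \<in> carrier (poly_ring n)) \<Longrightarrow> jacobian_minor r g Q \<in> carrier (poly_ring n)"
  unfolding jacobian_minor_def by (rule det_in_carrier[of _ r]) (simp_all add: mpoly_deriv_carrier)

text \<open>
  The rows are changed one at a time from generators to arbitrary elements of \<open>J\<close>. As a function of one
  row polynomial, the minor is additive, and by the product rule it is linear over the ring modulo
  \<open>J\<close>. Hence the polynomials of \<open>J\<close> for which the minor stays in \<open>I\<close> form an ideal, and this ideal
  contains the generators.
\<close>

lemma jacobian_minor_of_ideal_elements:
  fixes I J :: "'k::comm_ring_1 mpoly set"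
  assumes I: "ideal I (poly_ring n)" and gens: "S \<subseteq> carrier (poly_ring n)" and J: "J = Idl\<^bsub>poly_ring n\<^esub> S"
    and JI: "J \<subseteq> I"
    and minors: "\<And>Q. (\<And>i. i < r \<Longrightarrow> Q i \<in> S) \<Longrightarrow> jacobian_minor r g Q \<in> I"
    and Q: "\<And>i. i < r \<Longrightarrow> Q i \<in> J"
  shows "jacobian_minor r g Q \<in> I"
proof -
  have ideal_J: "ideal J (poly_ring n)" using J genideal_poly_ring_ideal[OF gens] by simp
  have SJ: "S \<subseteq> J" using J genideal_poly_ring_self[OF gens] by simp
  \<comment> \<open>Induction on the number \<open>k\<close> of leading rows that come from arbitrary elements of \<open>J\<close>.\<close>
  have "jacobian_minor r g Q \<in> I"
    if "k \<le> r" "\<And>i. i < k \<Longrightarrow> Q i \<in> J" "\<And>i. k \<le> i \<Longrightarrow> i < r \<Longrightarrow> Q i \<in> S" for k Q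
    using that
  proof (induction k arbitrary: Q)
    case 0
    then show ?case using minors by simp
  next
    case (Suc m)
    then have m: "m < r" by simp
    have QJ: "Q i \<in> J" if "i < r" for i
      using Suc.prems that SJ by (cases "i < Suc m") auto
    let ?K = "{q \<in> J. jacobian_minor r g (Q(m := q)) \<in> I}"
    have "ideal ?K (poly_ring n)"
    proof (rule ideal_poly_ringI)
      show "?K \<subseteq> carrier (poly_ring n)" using poly_ideal_carrier[OF ideal_J] by auto
      have "jacobian_minor r g (Q(m := 0)) = 0"
        using jacobian_minor_add[OF m, of g Q 0 0] by simp
      then show "0 \<in> ?K" using poly_ideal_0[OF ideal_J] poly_ideal_0[OF I] by simp
      fix a b assume "a \<in> ?K" "b \<in> ?K"
      then show "a + b \<in> ?K"
        using poly_ideal_add[OF ideal_J] poly_ideal_add[OF I] by (auto simp: jacobian_minor_add[OF m])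
    next
      fix h a :: "'k mpoly" assume h: "h \<in> carrier (poly_ring n)" and a: "a \<in> ?K"
      have "jacobian_minor r g (Q(m := h)) \<in> carrier (poly_ring n)"
        by (rule jacobian_minor_in_carrier) (use h QJ poly_ideal_carrier[OF ideal_J] in auto)
      then have "a * jacobian_minor r g (Q(m := h)) \<in> I"
        using a JI poly_ideal_mult'[OF I] by auto
      then show "h * a \<in> ?K"
        using a h poly_ideal_mult[OF ideal_J] poly_ideal_mult[OF I] poly_ideal_add[OF I]
        by (auto simp: jacobian_minor_mult[OF m])
    qed
    moreover have "S \<subseteq> ?K"
    proof
      fix s assume s: "s \<in> S"
      have "jacobian_minor r g (Q(m := s)) \<in> I"
        by (rule Suc.IH) (use Suc.prems s in auto)
      then show "s \<in> ?K" using s SJ by auto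
    qed
    ultimately have "J \<subseteq> ?K" unfolding J by (rule genideal_poly_ring_minimal)
    moreover have "Q m \<in> J" using QJ m by simp
    ultimately show ?case by auto
  qed
  from this[of r Q] Q show ?thesis by simp
qed

section \<open>Points in general position\<close>

text \<open>
  Over a finite field, the polynomial \<open>1 + \<Prod> (x - a)\<close>, with \<open>a\<close> ranging over the field, has no root.
\<close>

lemma infinite_UNIV_alg_closed: "infinite (UNIV :: 'a::alg_closed_field set)"
proof
  assume fin: "finite (UNIV :: 'a set)"
  let ?p = "\<Prod>a\<in>(UNIV :: 'a set). [:- a, 1:]"
  have deg: "degree ?p = card (UNIV :: 'a set)"
    by (subst degree_prod_eq_sum_degree) auto
  moreover have "0 < card (UNIV :: 'a set)" using fin by (simp add: card_gt_0_iff)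
  ultimately have "degree (?p + 1) > 0" by (subst degree_add_eq_left) auto
  then obtain x where "poly (?p + 1) x = 0" using alg_closed_imp_poly_has_root by blast
  moreover have "poly ?p x = 0" using fin by (auto simp: poly_prod intro!: prod_zero bexI[of _ x])
  ultimately show False by simp
qed

text \<open>
  The \<open>n + 3\<close> points are given by an indexed family of coordinate vectors. An infinite field is needed to pass
  from the vanishing of a polynomial on a punctured line through the origin to the vanishing of its
  homogeneous parts.
\<close>

locale general_points =
  fixes n :: nat and P :: "'p set" and v :: "'p \<Rightarrow> 'k::field vec"
  assumes infinite_field: "infinite (UNIV :: 'k set)"
    and n_ge_4: "4 \<le> n"
    and card_P: "card P = n + 3"
    and v_carrier: "p \<in> P \<Longrightarrow> v p \<in> carrier_vec (n + 1)"
    and general: "T \<subseteq> P \<Longrightarrow> card T = n + 1 \<Longrightarrow> a \<in> carrier_vec (n + 1) \<Longrightarrow>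
      (\<And>p. p \<in> T \<Longrightarrow> a \<bullet> v p = 0) \<Longrightarrow> a = 0\<^sub>v (n + 1)"
begin

lemma finite_P: "finite P"
  using card_P by (metis add_is_0 card.infinite zero_neq_numeral)

text \<open>
  Extend \<open>S \<union> {q}\<close> to a set of \<open>n + 1\<close> points. The matrix of their coordinates is invertible, since a
  vector in its kernel would be a hyperplane through these points, and a column of the inverse is the
  coefficient vector of the wanted linear form.
\<close>

lemma separating_linear_form:
  assumes "S \<subseteq> P" "card S \<le> n" "q \<in> P" "q \<notin> S"
  shows "\<exists>a\<in>carrier_vec (n + 1). a \<bullet> v q = 1 \<and> (\<forall>p\<in>S. a \<bullet> v p = 0)"
proof -
  have "n \<le> card (P - {q})" using card_P assms(3) by (simp add: card_Diff_singleton)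
  then obtain T0 where T0: "S \<subseteq> T0" "T0 \<subseteq> P - {q}" "card T0 = n"
    using exists_subset_between[of S n "P - {q}"] assms finite_P by auto
  define T where "T = insert q T0"
  have "finite T0" using T0 finite_P by (meson finite_Diff finite_subset)
  moreover have "q \<notin> T0" using T0 by auto
  ultimately have T: "T \<subseteq> P" "card T = n + 1" "finite T" using T0 assms by (auto simp: T_def)
  obtain h where h: "bij_betw h {0..<n + 1} T" using ex_bij_betw_nat_finite[OF T(3)] T(2) by auto
  have hT: "h i \<in> T" if "i < n + 1" for i using h that by (auto simp: bij_betw_def)
  define M where "M = mat (n + 1) (n + 1) (\<lambda>(i, j). v (h i) $ j)"
  have M: "M \<in> carrier_mat (n + 1) (n + 1)" by (simp add: M_def)
  have row: "row M i = v (h i)" if "i < n + 1" for i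
    using that v_carrier[of "h i"] hT[OF that] T by (intro eq_vecI) (auto simp: M_def)
  have "det M \<noteq> 0"
  proof
    assume "det M = 0"
    then obtain w where w: "w \<in> carrier_vec (n + 1)" "w \<noteq> 0\<^sub>v (n + 1)" "M *\<^sub>v w = 0\<^sub>v (n + 1)"
      using det_0_iff_vec_prod_zero_field[OF M] by auto
    have "w \<bullet> v p = 0" if "p \<in> T" for p
    proof -
      from that h obtain i where i: "i < n + 1" "h i = p" by (auto simp: bij_betw_def)
      have "row M i \<bullet> w = (M *\<^sub>v w) $ i" using i(1) M by simp
      also have "\<dots> = 0" using i(1) unfolding w(3) by (rule index_zero_vec(1))
      finally show ?thesis
        using comm_scalar_prod[OF w(1) v_carrier[of p]] that T row[OF i(1)] i(2) by auto
    qed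
    then show False using general[OF T(1,2) w(1)] w(2) by blast
  qed
  then obtain B where B: "B \<in> carrier_mat (n + 1) (n + 1)" "M * B = 1\<^sub>m (n + 1)"
    using det_non_zero_imp_unit[OF M, of "()"] unfolding Units_def ring_mat_def by auto
  have "q \<in> h ` {0..<n + 1}" using h by (simp add: bij_betw_def T_def)
  then obtain i0 where i0: "i0 < n + 1" "h i0 = q" by auto
  have prod: "col B i0 \<bullet> v (h i) = (if i = i0 then 1 else 0)" if "i < n + 1" for i
  proof -
    have "row M i \<bullet> col B i0 = (M * B) $$ (i, i0)" using M B(1) that i0 by simp
    then show ?thesis
      using that i0 row[OF that] comm_scalar_prod[of "v (h i)" "n + 1" "col B i0"] v_carrier[of "h i"]
        hT[OF that] T B by auto
  qed
  show ?thesis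
  proof (rule bexI[of _ "col B i0"], intro conjI ballI)
    show "col B i0 \<bullet> v q = 1" using prod i0 by auto
    fix p assume "p \<in> S"
    then have "p \<in> T" "p \<noteq> q" using T0 by (auto simp: T_def)
    then have "p \<in> h ` {0..<n + 1}" using h by (simp add: bij_betw_def)
    then obtain i where "i < n + 1" "h i = p" by auto
    moreover have "i \<noteq> i0" using calculation i0 \<open>p \<noteq> q\<close> by auto
    ultimately show "col B i0 \<bullet> v p = 0" using prod by auto
  qed (use B i0 in auto)
qed

text \<open>
  The ideal of the cone over the points. It agrees with the intersection of the homogeneous ideals of
  the points, but membership is a mere vanishing condition.
\<close>

definition J :: "'k mpoly set" where
  "J = {f \<in> carrier (poly_ring n). \<forall>p\<in>P. \<forall>c. c \<noteq> 0 \<longrightarrow> mpoly_eval f (c \<cdot>\<^sub>v v p) = 0}"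

lemma J_ideal: "ideal J (poly_ring n)"
  by (rule ideal_poly_ringI) (auto simp: J_def mpoly_eval_add mpoly_eval_mult)

lemma form_in_J_iff: "f \<in> form_space n d \<Longrightarrow> f \<in> J \<longleftrightarrow> (\<forall>p\<in>P. mpoly_eval f (v p) = 0)"
proof -
  assume f: "f \<in> form_space n d"
  have "mpoly_eval f (c \<cdot>\<^sub>v v p) = c ^ d * mpoly_eval f (v p)" if "p \<in> P" for c p
    using form_eval_scale[OF f v_carrier[OF that]] .
  moreover have "1 \<cdot>\<^sub>v v p = v p" for p by simp
  ultimately show ?thesis
    using form_space_carrier[OF f] unfolding J_def
    by auto
qed

text \<open>
  For fixed \<open>p\<close>, the value of \<open>f\<close> at \<open>c \<cdot>\<^sub>v v p\<close> is a polynomial in \<open>c\<close> whose coefficients are the values of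
  the homogeneous parts of \<open>f\<close> at \<open>v p\<close>. It has infinitely many roots.
\<close>

lemma form_part_in_J:
  assumes "f \<in> J"
  shows "form_part d f \<in> J"
proof -
  have car: "f \<in> carrier (poly_ring n)" using assms by (simp add: J_def)
  have "mpoly_eval (form_part d f) (v p) = 0" if p: "p \<in> P" for p
  proof -
    let ?D = "monomial_degree ` Poly_Mapping.keys f"
    let ?e = "\<lambda>d. mpoly_eval (form_part d f) (v p)"
    define r where "r = (\<Sum>d\<in>?D. Polynomial.monom (?e d) d)"
    have "poly r c = 0" if "c \<noteq> 0" for c
    proof -
      have "poly r c = (\<Sum>d\<in>?D. mpoly_eval (form_part d f) (c \<cdot>\<^sub>v v p))"
        unfolding r_def poly_sum
        by (intro sum.cong)
           (auto simp: poly_monom form_eval_scale[OF form_part_in[OF car] v_carrier[OF p]])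
      also have "\<dots> = mpoly_eval f (c \<cdot>\<^sub>v v p)"
        by (subst (2) poly_as_sum_of_forms[of f]) (simp only: mpoly_eval_sum)
      also have "\<dots> = 0" using assms p that by (simp add: J_def)
      finally show ?thesis .
    qed
    then have "UNIV - {0} \<subseteq> {c. poly r c = 0}" by auto
    moreover have "infinite (UNIV - {0 :: 'k})" using infinite_field by simp
    ultimately have "r = 0" using poly_roots_finite finite_subset by blast
    show ?thesis
    proof (cases "d \<in> ?D")
      case True
      have "Polynomial.coeff r d = ?e d"
        unfolding r_def coeff_sum using True by (simp add: coeff_monom sum.delta)
      then show ?thesis using \<open>r = 0\<close> by simp
    next
      case False
      then have "form_part d f = 0" using keys_form_part[of d f] by (auto simp: image_iff keys_eq_empty[symmetric])
      then show ?thesis by simp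
    qed
  qed
  then show ?thesis using form_in_J_iff[OF form_part_in[OF car]] by blast
qed

text \<open>
  A nonzero constant vanishes nowhere, and no hyperplane contains all the points.
\<close>

lemma J_subset_order_ge_2: "J \<subseteq> order_ge n 2"
proof
  fix f assume f: "f \<in> J"
  have car: "f \<in> carrier (poly_ring n)" using f by (simp add: J_def)
  obtain T where T: "T \<subseteq> P" "card T = n + 1" "finite T"
    using obtain_subset_with_card_n[of "n + 1" P] card_P by auto
  then obtain q where q: "q \<in> T" by (metis add_is_0 card.empty equals0I zero_neq_one)
  have "form_part d f = 0" if "d < 2" for d
  proof -
    define g where "g = form_part d f"
    have g: "g \<in> form_space n d" unfolding g_def by (rule form_part_in[OF car])
    have van: "mpoly_eval g (v p) = 0" if "p \<in> P" for p
      using form_in_J_iff[OF g] form_part_in_J[OF f] that by (simp add: g_def)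
    consider "d = 0" | "d = 1" using \<open>d < 2\<close> by linarith
    then have "g = 0"
    proof cases
      case 1
      have "Poly_Mapping.keys g \<subseteq> {0}" using g 1 by (auto simp: form_space_def monomial_degree_eq_0)
      then have eq: "g = Poly_Mapping.single 0 (Poly_Mapping.lookup g 0)"
        by (intro poly_mapping_eqI) (auto simp: lookup_single when_def in_keys_iff)
      have "mpoly_eval g (v q) = Poly_Mapping.lookup g 0"
        by (subst eq) (simp add: mpoly_eval_single)
      then show ?thesis using eq van[of q] q T by auto
    next
      case 2
      then obtain a where a: "a \<in> carrier_vec (n + 1)" "g = linear_form n a"
        using form_space_1_linear_form[of g n] g by (metis vec_carrier)
      have "a \<bullet> v p = 0" if "p \<in> T" for p
        using van[of p] mpoly_eval_linear_form[OF v_carrier[of p], of a] that T a by auto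
      then have "a = 0\<^sub>v (n + 1)" using general[OF T(1,2) a(1)] by blast
      then show ?thesis using a by (simp add: linear_form_def)
    qed
    then show ?thesis by (simp add: g_def)
  qed
  then have "monomial_degree m \<noteq> d" if "m \<in> Poly_Mapping.keys f" "d < 2" for m d
    using keys_form_part[of d f] that by auto
  then show "f \<in> order_ge n 2" using car by (auto simp: order_ge_def not_less[symmetric])
qed

text \<open>
  Two hyperplanes that avoid \<open>q\<close> cover the other \<open>n + 2\<close> points; a repeated factor raises the degree.
\<close>

lemma separating_form:
  assumes q: "q \<in> P" and d: "2 \<le> d"
  shows "\<exists>h\<in>form_space n d. mpoly_eval h (v q) = 1 \<and> (\<forall>p\<in>P - {q}. mpoly_eval h (v p) = 0)"
proof -
  have card: "card (P - {q}) = n + 2" using q card_P by (simp add: card_Diff_singleton)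
  obtain S where S: "S \<subseteq> P - {q}" "card S = 2" "finite S"
    using obtain_subset_with_card_n[of 2 "P - {q}"] card by auto
  have card': "card (P - {q} - S) = n" using card_Diff_subset[OF S(3,1)] card S(2) by simp
  obtain a where a: "a \<bullet> v q = 1" "\<And>p. p \<in> S \<Longrightarrow> a \<bullet> v p = 0"
    using separating_linear_form[of S q] S q n_ge_4 by auto
  obtain b where b: "b \<bullet> v q = 1" "\<And>p. p \<in> P - {q} - S \<Longrightarrow> b \<bullet> v p = 0"
    using separating_linear_form[of "P - {q} - S" q] card' q by auto
  define h where "h = linear_form n a ^ (d - 1) * linear_form n b"
  have "linear_form n a ^ (d - 1) * linear_form n b \<in> form_space n ((d - 1) * 1 + 1)"
    by (intro form_space_mult form_space_power linear_form_in)
  then have "h \<in> form_space n d" using d by (simp add: h_def)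
  moreover have ev: "mpoly_eval h (v p) = (a \<bullet> v p) ^ (d - 1) * (b \<bullet> v p)" if "p \<in> P" for p
  proof -
    interpret comm_ring_hom "\<lambda>f :: 'k mpoly. mpoly_eval f (v p)" by (rule mpoly_eval_hom)
    show ?thesis using that v_carrier by (simp add: h_def hom_mult hom_power mpoly_eval_linear_form)
  qed
  moreover have "(a \<bullet> v p) ^ (d - 1) * (b \<bullet> v p) = 0" if "p \<in> P - {q}" for p
    using that a(2)[of p] b(2)[of p] d by (cases "p \<in> S") auto
  ultimately show ?thesis using a(1) b(1) q by (intro bexI[of _ h]) auto
qed

text \<open>
  Write \<open>f = \<Sum> x\<^sub>i G\<^sub>i\<close>. At a point \<open>p\<close> of the cone, the vector of the values \<open>G\<^sub>i(p)\<close> is orthogonal to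
  \<open>p\<close>, hence it is the value of a Koszul syzygy. Multiplying this syzygy by a form that is 1 at \<open>p\<close> and 0 at
  the other points, and subtracting the results for all \<open>p\<close>, makes the coefficients vanish on all points
  without changing the sum.
\<close>

lemma J_forms_split:
  assumes f: "f \<in> form_space n (Suc d)" "f \<in> J" and d: "3 \<le> d"
  shows "\<exists>F. (\<forall>i\<le>n. F i \<in> form_space n d \<inter> J) \<and> f = (\<Sum>i\<le>n. variable i * F i)"
proof -
  obtain G where G: "\<And>i. G i \<in> form_space n d" "f = (\<Sum>i\<le>n. variable i * G i)"
    using form_split_variables[OF f(1)] by blast
  have "\<forall>p\<in>P. \<exists>h. h \<in> form_space n (d - 1) \<and> mpoly_eval h (v p) = 1 \<and>
      (\<forall>p'\<in>P - {p}. mpoly_eval h (v p') = 0)"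
    using separating_form[of _ "d - 1"] d by (simp add: Bex_def)
  then obtain h where h: "\<And>p. p \<in> P \<Longrightarrow> h p \<in> form_space n (d - 1)"
    "\<And>p. p \<in> P \<Longrightarrow> mpoly_eval (h p) (v p) = 1"
    "\<And>p p'. p \<in> P \<Longrightarrow> p' \<in> P \<Longrightarrow> p' \<noteq> p \<Longrightarrow> mpoly_eval (h p) (v p') = 0"
    by (metis (no_types, lifting) Diff_iff empty_iff insert_iff)
  have "\<forall>p\<in>P. \<exists>l. l \<bullet> v p = 1" using separating_linear_form[of "{}"] by auto
  then obtain l where l: "\<And>p. p \<in> P \<Longrightarrow> l p \<bullet> v p = 1" by metis
  define g where "g p = vec (n + 1) (\<lambda>i. mpoly_eval (G i) (v p))" for p
  let ?c = "\<lambda>x. Poly_Mapping.single 0 x :: 'k mpoly"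
  \<comment> \<open>The \<open>p\<close>-th summands are \<open>h p\<close> times the Koszul syzygy with entries \<open>g\<^sub>i \<lambda> - \<lambda>\<^sub>i g\<close> for the linear forms
    \<open>g = \<Sum> g\<^sub>i x\<^sub>i\<close> with \<open>g\<^sub>i = G\<^sub>i(p)\<close>, and \<open>\<lambda> = \<Sum> \<lambda>\<^sub>i x\<^sub>i\<close> with \<open>\<lambda>(p) = 1\<close>. As \<open>g(p) = f(p) = 0\<close>, its value at \<open>p\<close>
    is the vector of the \<open>g\<^sub>i\<close>.\<close>
  define F where "F i = G i - (\<Sum>p\<in>P. h p * linear_form n (l p) * ?c (g p $ i))
    + (\<Sum>p\<in>P. h p * linear_form n (g p) * ?c (l p $ i))" for i
  have F_form: "F i \<in> form_space n d" for i
  proof -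
    have "h p * linear_form n a * ?c x \<in> form_space n d" if "p \<in> P" for p a x
      using form_space_mult[OF form_space_mult[OF h(1)[OF that] linear_form_in] form_space_const, of a x] d
      by simp
    then show ?thesis unfolding F_def
      by (intro form_space_add form_space_diff form_space_sum G) auto
  qed
  have ev: "mpoly_eval (\<Sum>p\<in>P. h p * linear_form n (a p) * ?c (b p)) (v q) = (a q \<bullet> v q) * b q"
    if q: "q \<in> P" for a b q
  proof -
    have "mpoly_eval (\<Sum>p\<in>P. h p * linear_form n (a p) * ?c (b p)) (v q) =
      (\<Sum>p\<in>P. if p = q then (a q \<bullet> v q) * b q else 0)"
      unfolding mpoly_eval_sum
      using h(2,3) q mpoly_eval_linear_form[OF v_carrier[OF q]]
      by (intro sum.cong) (auto simp: mpoly_eval_mult mpoly_eval_single)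
    then show ?thesis using q finite_P by simp
  qed
  have F_van: "mpoly_eval (F i) (v q) = 0" if q: "q \<in> P" and i: "i \<le> n" for i q
  proof -
    interpret comm_ring_hom "\<lambda>f :: 'k mpoly. mpoly_eval f (v q)" by (rule mpoly_eval_hom)
    have "g q \<bullet> v q = (\<Sum>j\<le>n. v q $ j * mpoly_eval (G j) (v q))"
      using v_carrier[OF q] unfolding g_def scalar_prod_def
      by (intro sum.cong) (auto simp: mult.commute)
    also have "\<dots> = mpoly_eval f (v q)"
      by (simp add: G(2) mpoly_eval_sum mpoly_eval_mult mpoly_eval_single)
    also have "\<dots> = 0" using form_in_J_iff[OF f(1)] f(2) q by blast
    finally have "g q \<bullet> v q = 0" .
    then show ?thesis
      using ev[OF q] l[OF q] i unfolding F_def by (simp add: hom_minus mpoly_eval_add g_def)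
  qed
  have "(\<Sum>i\<le>n. variable i * F i) = f"
  proof -
    have exch: "(\<Sum>i\<le>n. variable i * (\<Sum>p\<in>P. h p * linear_form n (a p) * ?c (b p $ i))) =
      (\<Sum>p\<in>P. h p * linear_form n (a p) * linear_form n (b p))" for a b
      unfolding linear_form_alt[of _ "b _"] sum_distrib_left
      by (subst sum.swap) (simp add: ac_simps)
    have "(\<Sum>i\<le>n. variable i * F i) = f - (\<Sum>p\<in>P. h p * linear_form n (l p) * linear_form n (g p))
        + (\<Sum>p\<in>P. h p * linear_form n (g p) * linear_form n (l p))"
      unfolding F_def
      by (simp only: ring_distribs right_diff_distrib sum.distrib sum_subtractf exch G(2)[symmetric])
    then show ?thesis by (simp add: ac_simps)
  qed
  then show ?thesis using F_form F_van form_in_J_iff[OF F_form]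
    by (intro exI[of _ F]) auto
qed

text \<open>
  The constant last row selects a combination of the maximal minors of the gradients.
\<close>

definition bordered_jacobian :: "(nat \<Rightarrow> 'k mpoly) \<Rightarrow> 'k vec \<Rightarrow> 'k mpoly mat" where
  "bordered_jacobian Q l = mat (n + 1) (n + 1)
     (\<lambda>(i, j). if i < n then mpoly_deriv j (Q i) else Poly_Mapping.single 0 (l $ j))"

text \<open>
  The matrix is singular at a point as soon as all its rows annihilate a common nonzero vector there.
  At the points \<open>s\<^sub>k\<close> this vector is \<open>s\<^sub>k\<close> itself, at \<open>p\<^sub>1\<close> and \<open>p\<^sub>2\<close> it lies on the line joining these points.
\<close>

lemma separating_jacobian_determinant:
  assumes q: "q \<in> P"
  shows "\<exists>Q l. (\<forall>i<n. Q i \<in> form_space n 2 \<inter> J) \<and>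
    mpoly_eval (det (bordered_jacobian Q l)) (v q) \<noteq> 0 \<and>
    (\<forall>p\<in>P - {q}. mpoly_eval (det (bordered_jacobian Q l)) (v p) = 0)"
proof -
  have card: "card (P - {q}) = n + 2" using q card_P by (simp add: card_Diff_singleton)
  obtain E where E: "E \<subseteq> P - {q}" "card E = 2" "finite E"
    using obtain_subset_with_card_n[of 2 "P - {q}"] card by auto
  then obtain p1 p2 where p12: "E = {p1, p2}" "p1 \<noteq> p2" by (auto simp: card_2_iff)
  define S where "S = P - {q} - E"
  have S: "card S = n" "finite S" "S \<subseteq> P" "q \<notin> S"
    using card_Diff_subset[OF E(3,1)] card E(2) finite_P by (auto simp: S_def)
  obtain s where s: "bij_betw s {0..<n} S" using ex_bij_betw_nat_finite[OF S(2)] S(1) by auto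
  have sS: "s i \<in> S" if "i < n" for i using s that by (auto simp: bij_betw_def)
  have s_inj: "s i = s j \<longleftrightarrow> i = j" if "i < n" "j < n" for i j
    using s that by (auto simp: bij_betw_def inj_on_def)
  obtain l where l: "l \<in> carrier_vec (n + 1)" "l \<bullet> v q = 1" "\<And>p. p \<in> S \<Longrightarrow> l \<bullet> v p = 0"
    using separating_linear_form[of S q] S q by auto
  have "\<exists>x\<in>carrier_vec (n + 1). x \<bullet> v (s i) = 1 \<and> (\<forall>p\<in>insert q (S - {s i}). x \<bullet> v p = 0)"
    if i: "i < n" for i
  proof (rule separating_linear_form)
    show "card (insert q (S - {s i})) \<le> n"
      using S sS[OF i] i by (simp add: card_Diff_singleton card_insert_if)
  qed (use S sS[OF i] q in auto)
  then obtain x where x: "\<And>i. i < n \<Longrightarrow> x i \<in> carrier_vec (n + 1)"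
    "\<And>i. i < n \<Longrightarrow> x i \<bullet> v (s i) = 1" "\<And>i. i < n \<Longrightarrow> x i \<bullet> v q = 0"
    "\<And>i p. i < n \<Longrightarrow> p \<in> S \<Longrightarrow> p \<noteq> s i \<Longrightarrow> x i \<bullet> v p = 0"
    by (metis (no_types, lifting) Diff_iff empty_iff insert_iff)
  have "\<exists>y\<in>carrier_vec (n + 1). y \<bullet> v q = 1 \<and> (\<forall>p\<in>{s i, p1, p2}. y \<bullet> v p = 0)"
    if i: "i < n" for i
  proof (rule separating_linear_form)
    show "card {s i, p1, p2} \<le> n"
      using n_ge_4 by (auto simp: card_insert_if)
  qed (use S sS[OF i] q E p12 in \<open>auto simp: S_def\<close>)
  then obtain y where y: "\<And>i. i < n \<Longrightarrow> y i \<in> carrier_vec (n + 1)"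
    "\<And>i. i < n \<Longrightarrow> y i \<bullet> v q = 1" "\<And>i. i < n \<Longrightarrow> y i \<bullet> v (s i) = 0"
    "\<And>i. i < n \<Longrightarrow> y i \<bullet> v p1 = 0" "\<And>i. i < n \<Longrightarrow> y i \<bullet> v p2 = 0"
    by (metis (no_types, lifting) insert_iff)
  define Q where "Q i = linear_form n (x i) * linear_form n (y i)" for i
  have P_cases: "p = q \<or> p = p1 \<or> p = p2 \<or> (\<exists>j<n. p = s j)" if "p \<in> P" for p
  proof (cases "p \<in> S")
    case True
    then show ?thesis using s by (auto simp: bij_betw_def)
  next
    case False
    then show ?thesis using that p12 by (auto simp: S_def)
  qed
  have p_in: "p1 \<in> P" "p2 \<in> P" "p1 \<notin> S" "p2 \<notin> S" "p1 \<noteq> q" "p2 \<noteq> q" using E p12 by (auto simp: S_def)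
  have Q_form: "Q i \<in> form_space n 2" for i
    unfolding Q_def using form_space_mult[OF linear_form_in linear_form_in] by (metis one_add_one)
  have Q_J: "Q i \<in> J" if i: "i < n" for i
    unfolding form_in_J_iff[OF Q_form]
  proof
    fix p assume p: "p \<in> P"
    have "(x i \<bullet> v p) * (y i \<bullet> v p) = 0"
      using P_cases[OF p] x[OF i] y[OF i] sS s_inj i by (metis mult_zero_left mult_zero_right)
    then show "mpoly_eval (Q i) (v p) = 0"
      using v_carrier[OF p] by (simp add: Q_def mpoly_eval_mult mpoly_eval_linear_form)
  qed
  \<comment> \<open>The value of the bordered Jacobian matrix at \<open>u\<close>.\<close>
  define B where "B u = mat (n + 1) (n + 1)
    (\<lambda>(i, j). if i < n then x i $ j * (y i \<bullet> u) + (x i \<bullet> u) * y i $ j else l $ j)" for u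
  have B_carrier: "B u \<in> carrier_mat (n + 1) (n + 1)" for u by (simp add: B_def)
  have eval_det: "mpoly_eval (det (bordered_jacobian Q l)) u = det (B u)"
    if u: "u \<in> carrier_vec (n + 1)" for u
  proof -
    interpret comm_ring_hom "\<lambda>f :: 'k mpoly. mpoly_eval f u" by (rule mpoly_eval_hom)
    have "map_mat (\<lambda>f. mpoly_eval f u) (bordered_jacobian Q l) = B u"
      by (rule eq_matI)
         (use u in \<open>auto simp: bordered_jacobian_def B_def Q_def eval_deriv_linear_product mpoly_eval_single\<close>)
    then show ?thesis using hom_det[of "bordered_jacobian Q l"] by simp
  qed
  have B_mult: "B u *\<^sub>v w = vec (n + 1)
      (\<lambda>i. if i < n then (x i \<bullet> w) * (y i \<bullet> u) + (x i \<bullet> u) * (y i \<bullet> w) else l \<bullet> w)"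
    if w: "w \<in> carrier_vec (n + 1)" for u w
  proof (rule eq_vecI)
    fix i assume "i < dim_vec (vec (n + 1)
      (\<lambda>i. if i < n then (x i \<bullet> w) * (y i \<bullet> u) + (x i \<bullet> u) * (y i \<bullet> w) else l \<bullet> w))"
    then have i: "i < n + 1" by simp
    show "(B u *\<^sub>v w) $ i = vec (n + 1)
      (\<lambda>i. if i < n then (x i \<bullet> w) * (y i \<bullet> u) + (x i \<bullet> u) * (y i \<bullet> w) else l \<bullet> w) $ i"
    proof (cases "i < n")
      case True
      have "row (B u) i = (y i \<bullet> u) \<cdot>\<^sub>v x i + (x i \<bullet> u) \<cdot>\<^sub>v y i"
        using True x(1)[OF True] y(1)[OF True] by (intro eq_vecI) (auto simp: B_def mult.commute)
      then have "row (B u) i \<bullet> w = (y i \<bullet> u) * (x i \<bullet> w) + (x i \<bullet> u) * (y i \<bullet> w)"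
        using add_scalar_prod_distrib[of "(y i \<bullet> u) \<cdot>\<^sub>v x i" "n + 1" "(x i \<bullet> u) \<cdot>\<^sub>v y i" w]
          x(1)[OF True] y(1)[OF True] w by simp
      then show ?thesis using True i B_carrier[of u] by (simp add: mult.commute)
    next
      case False
      have "row (B u) i = l" using False i l(1) by (intro eq_vecI) (auto simp: B_def)
      then show ?thesis using False i B_carrier[of u] by simp
    qed
  qed (simp add: B_def)
  have det_B_0: "det (B u) = 0"
    if "w \<in> carrier_vec (n + 1)" "w \<noteq> 0\<^sub>v (n + 1)" "l \<bullet> w = 0"
      "\<And>i. i < n \<Longrightarrow> (x i \<bullet> w) * (y i \<bullet> u) + (x i \<bullet> u) * (y i \<bullet> w) = 0" for u w
  proof -
    have "B u *\<^sub>v w = 0\<^sub>v (n + 1)"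
      unfolding B_mult[OF that(1)] by (rule eq_vecI) (use that in auto)
    then show ?thesis using det_0_iff_vec_prod_zero_field[OF B_carrier] that(1,2) by blast
  qed
  have v_nonzero: "v p \<noteq> 0\<^sub>v (n + 1)" if p: "p \<in> P" for p
  proof
    assume "v p = 0\<^sub>v (n + 1)"
    moreover obtain a where "a \<in> carrier_vec (n + 1)" "a \<bullet> v p = 1"
      using separating_linear_form[of "{}" p] p by (auto simp del: One_nat_def)
    ultimately show False by simp
  qed
  have at_s: "det (B (v (s k))) = 0" if k: "k < n" for k
  proof (rule det_B_0[of "v (s k)"])
    have P: "s k \<in> P" using sS[OF k] S by auto
    show "v (s k) \<in> carrier_vec (n + 1)" "v (s k) \<noteq> 0\<^sub>v (n + 1)" "l \<bullet> v (s k) = 0"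
      using v_carrier[OF P] v_nonzero[OF P] l(3) sS[OF k] by auto
    fix i assume i: "i < n"
    have "(x i \<bullet> v (s k)) * (y i \<bullet> v (s k)) = 0"
      using x(4)[OF i sS[OF k]] y(3)[OF i] s_inj[OF i k] by (cases "i = k") auto
    then show "(x i \<bullet> v (s k)) * (y i \<bullet> v (s k)) + (x i \<bullet> v (s k)) * (y i \<bullet> v (s k)) = 0" by simp
  qed
  have at_p: "det (B (v a)) = 0"
    if a: "a \<in> P" and b: "b \<in> P" "b \<noteq> a" and ya: "\<And>i. i < n \<Longrightarrow> y i \<bullet> v a = 0"
      and yb: "\<And>i. i < n \<Longrightarrow> y i \<bullet> v b = 0" for a b
  proof (cases "l \<bullet> v a = 0")
    case True
    then show ?thesis
      by (intro det_B_0[of "v a"]) (use v_carrier[OF a] v_nonzero[OF a] ya in auto)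
  next
    case False
    \<comment> \<open>The point where the line through \<open>v a\<close> and \<open>v b\<close> meets the hyperplane \<open>l = 0\<close>.\<close>
    define w where "w = (l \<bullet> v b) \<cdot>\<^sub>v v a - (l \<bullet> v a) \<cdot>\<^sub>v v b"
    have w: "w \<in> carrier_vec (n + 1)" using v_carrier a b by (simp add: w_def)
    have dot: "z \<bullet> w = (l \<bullet> v b) * (z \<bullet> v a) - (l \<bullet> v a) * (z \<bullet> v b)" if "z \<in> carrier_vec (n + 1)" for z
      using that v_carrier[OF a] v_carrier[OF b(1)] unfolding w_def
      by (subst scalar_prod_minus_distrib[of _ "n + 1"]) auto
    obtain z where z: "z \<in> carrier_vec (n + 1)" "z \<bullet> v b = 1" "z \<bullet> v a = 0"
      using separating_linear_form[of "{a}" b] a b n_ge_4 by auto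
    show ?thesis
    proof (rule det_B_0[OF w])
      show "w \<noteq> 0\<^sub>v (n + 1)" using dot[OF z(1)] z False by auto
      show "l \<bullet> w = 0" using dot[OF l(1)] by simp
      fix i assume i: "i < n"
      show "(x i \<bullet> w) * (y i \<bullet> v a) + (x i \<bullet> v a) * (y i \<bullet> w) = 0"
        using dot[OF y(1)[OF i]] ya[OF i] yb[OF i] by simp
    qed
  qed
  \<comment> \<open>Up to the values \<open>y i \<bullet> v q = 1\<close>, the rows at \<open>q\<close> are the basis dual to \<open>s 0, \<dots>, s (n - 1), q\<close>.\<close>
  have at_q: "det (B (v q)) \<noteq> 0"
  proof -
    define C where "C = mat (n + 1) (n + 1) (\<lambda>(i, j). (if j < n then v (s j) else v q) $ i)"
    have C: "C \<in> carrier_mat (n + 1) (n + 1)" by (simp add: C_def)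
    have col: "col C j = (if j < n then v (s j) else v q)" if "j < n + 1" for j
      using that v_carrier[of q] v_carrier[of "s j"] sS[of j] S q
      by (intro eq_vecI) (auto simp: C_def)
    have row: "row (B (v q)) i = (if i < n then x i else l)" if "i < n + 1" for i
      using that x(1,3)[of i] y(2)[of i] l(1) by (intro eq_vecI) (auto simp: B_def)
    have "B (v q) * C = 1\<^sub>m (n + 1)"
    proof (rule eq_matI)
      fix i j assume "i < dim_row (1\<^sub>m (n + 1) :: 'k mat)" "j < dim_col (1\<^sub>m (n + 1) :: 'k mat)"
      then have ij: "i < n + 1" "j < n + 1" by auto
      have "(B (v q) * C) $$ (i, j) = (if i < n then x i else l) \<bullet> (if j < n then v (s j) else v q)"
        using ij B_carrier[of "v q"] C row[OF ij(1)] col[OF ij(2)] by simp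
      also have "\<dots> = (if i = j then 1 else 0)"
        using ij x(2,3)[of i] x(4)[of i "s j"] l(2,3) sS[of j] s_inj[of i j] by auto
      finally show "(B (v q) * C) $$ (i, j) = 1\<^sub>m (n + 1) $$ (i, j)" using ij by simp
    qed (use B_carrier[of "v q"] C in auto)
    then have "det (B (v q)) * det C = 1" using det_mult[OF B_carrier C] by (metis det_one)
    then show ?thesis by auto
  qed
  have "\<forall>p\<in>P - {q}. mpoly_eval (det (bordered_jacobian Q l)) (v p) = 0"
    using P_cases at_s at_p[of p1 p2] at_p[of p2 p1] p_in p12 y(4,5) eval_det[OF v_carrier] by auto
  then show ?thesis using Q_form Q_J at_q eval_det[OF v_carrier[OF q]]
    by (intro exI[of _ Q] exI[of _ l]) auto
qed

end

section \<open>The Jacobian ideal of the points\<close>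

context general_points
begin

text \<open>
  Iterating \<open>J_forms_split\<close> \<open>e\<close> times moves \<open>e\<close> variables into the second factor. It starts in degree
  \<open>n \<ge> 4\<close>, where that lemma applies.
\<close>

lemma J_order_ge_subset:
  "J \<inter> order_ge n (n + e) \<subseteq> ideal_prod (poly_ring n) J (order_ge n e)"
proof
  have forms: "f \<in> ideal_prod (poly_ring n) J (order_ge n e)"
    if "f \<in> form_space n d" "f \<in> J" "n + e \<le> d" for f d e
    using that
  proof (induction e arbitrary: f d)
    case 0
    have "f * 1 \<in> ideal_prod (poly_ring n) J (order_ge n 0)"
      by (rule ideal_prod_mult_mem) (use 0 in \<open>auto simp: order_ge_0_eq\<close>)
    then show ?case by simp
  next
    case (Suc e)
    then obtain d' where d': "d = Suc d'" "n + e \<le> d'" by (cases d) auto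
    have ideal: "ideal (ideal_prod (poly_ring n) J (order_ge n (Suc e))) (poly_ring n)"
      by (intro ideal_prod_poly_ring_ideal J_ideal order_ge_ideal)
    have "3 \<le> d'" using d' n_ge_4 by simp
    then obtain F where F: "\<And>i. i \<le> n \<Longrightarrow> F i \<in> form_space n d' \<inter> J" "f = (\<Sum>i\<le>n. variable i * F i)"
      using J_forms_split[of f d'] Suc.prems d' by blast
    have "variable i * F i \<in> ideal_prod (poly_ring n) J (order_ge n (Suc e))" if "i \<le> n" for i
    proof (rule ideal_prod_mult_right)
      show "F i \<in> ideal_prod (poly_ring n) J (order_ge n e)"
        using Suc.IH[of "F i" d'] F(1)[OF that] d' by auto
      fix g :: "'k mpoly" assume "g \<in> order_ge n e"
      moreover have "variable i \<in> order_ge n 1"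
        using single_variable_in[OF that, of 1] form_space_subset_order_ge by blast
      ultimately show "variable i * g \<in> order_ge n (Suc e)" using order_ge_mult by force
    qed
    then show ?case unfolding F(2) by (intro poly_ideal_sum[OF ideal]) auto
  qed
  fix f assume f: "f \<in> J \<inter> order_ge n (n + e)"
  have ideal: "ideal (ideal_prod (poly_ring n) J (order_ge n e)) (poly_ring n)"
    by (intro ideal_prod_poly_ring_ideal J_ideal order_ge_ideal)
  have "(\<Sum>d\<in>monomial_degree ` Poly_Mapping.keys f. form_part d f) \<in> ideal_prod (poly_ring n) J (order_ge n e)"
  proof (rule poly_ideal_sum[OF ideal])
    fix d assume "d \<in> monomial_degree ` Poly_Mapping.keys f"
    then have "n + e \<le> d" using f by (auto simp: order_ge_def)
    then show "form_part d f \<in> ideal_prod (poly_ring n) J (order_ge n e)"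
      using forms[of "form_part d f" d e] form_part_in[of f n d] form_part_in_J[of f d] f
        poly_ideal_carrier[OF J_ideal] by auto
  qed
  then show "f \<in> ideal_prod (poly_ring n) J (order_ge n e)"
    by (simp only: poly_as_sum_of_forms[symmetric])
qed

context
  fixes gs :: "'k mpoly list"
  assumes gs: "set gs \<subseteq> carrier (poly_ring n)" "Idl\<^bsub>poly_ring n\<^esub> (set gs) = J"
begin

abbreviation I :: "'k mpoly set" where
  "I \<equiv> jacobian_ideal n gs"

lemma jacobian_matrix_dims:
  "dim_row (jacobian_matrix n gs) = length gs" "dim_col (jacobian_matrix n gs) = n + 1"
  by (simp_all add: jacobian_matrix_def)

lemma gs_in_J: "set gs \<subseteq> J"
  using genideal_poly_ring_self[OF gs(1)] gs(2) by simp

lemma jacobian_matrix_entries: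
  assumes "i < dim_row (jacobian_matrix n gs)" "j < dim_col (jacobian_matrix n gs)"
  shows "jacobian_matrix n gs $$ (i, j) \<in> order_ge n 1"
proof -
  have "gs ! i \<in> order_ge n 2"
    using assms gs_in_J J_subset_order_ge_2 by (force simp: jacobian_matrix_dims)
  from mpoly_deriv_order_ge[OF this, of j] show ?thesis
    using assms by (simp add: jacobian_matrix_def)
qed

text \<open>
  The ideal \<open>J\<close> has no nonzero forms of degree below 2, so all partial derivatives of its elements have order at least 1.
\<close>

lemma minors_ideal_subset: "minors_ideal n n (jacobian_matrix n gs) \<subseteq> order_ge n n"
  unfolding minors_ideal_def
  using minors_generators_carrier[OF jacobian_matrix_entries, of _ n]
  by (intro genideal_poly_ring_minimal[OF order_ge_ideal]) auto

lemma
  shows I_ideal: "ideal I (poly_ring n)"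
    and J_subset_I: "J \<subseteq> I"
    and minors_subset_I: "minors_ideal n n (jacobian_matrix n gs) \<subseteq> I"
    and I_subset: "I \<subseteq> {a + b | a b. a \<in> J \<and> b \<in> order_ge n n}"
proof -
  let ?S = "J \<union> minors_ideal n n (jacobian_matrix n gs)"
  have I: "I = Idl\<^bsub>poly_ring n\<^esub> ?S" by (simp add: jacobian_ideal_def gs(2))
  have S: "?S \<subseteq> carrier (poly_ring n)"
    using poly_ideal_carrier[OF J_ideal] minors_ideal_subset order_ge_carrier by blast
  show "ideal I (poly_ring n)" unfolding I by (rule genideal_poly_ring_ideal[OF S])
  show "J \<subseteq> I" "minors_ideal n n (jacobian_matrix n gs) \<subseteq> I"
    unfolding I using genideal_poly_ring_self[OF S] by auto
  show "I \<subseteq> {a + b | a b. a \<in> J \<and> b \<in> order_ge n n}"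
    unfolding I
  proof (rule genideal_poly_ring_minimal)
    show "ideal {a + b | a b. a \<in> J \<and> b \<in> order_ge n n} (poly_ring n)"
      by (rule sum_of_ideals_ideal[OF J_ideal order_ge_ideal])
    have "x = x + 0" "x = 0 + x" for x :: "'k mpoly" by auto
    then show "?S \<subseteq> {a + b | a b. a \<in> J \<and> b \<in> order_ge n n}"
      using minors_ideal_subset poly_ideal_0[OF J_ideal] poly_ideal_0[OF order_ge_ideal] by blast
  qed
qed

lemma jacobian_minor_in_I:
  assumes "\<And>j. j < n \<Longrightarrow> g j \<le> n" "\<And>i. i < n \<Longrightarrow> Q i \<in> J"
  shows "jacobian_minor n g Q \<in> I"
proof (rule jacobian_minor_of_ideal_elements[OF I_ideal gs(1) gs(2)[symmetric] J_subset_I])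
  fix Q assume "\<And>i. i < n \<Longrightarrow> Q i \<in> set gs"
  then have "\<forall>i. \<exists>k. i < n \<longrightarrow> k < length gs \<and> gs ! k = Q i" by (meson in_set_conv_nth)
  then obtain f where f: "\<And>i. i < n \<Longrightarrow> f i < length gs" "\<And>i. i < n \<Longrightarrow> gs ! f i = Q i" by metis
  have "jacobian_minor n g Q = det (mat n n (\<lambda>(i, j). jacobian_matrix n gs $$ (f i, g j)))"
    unfolding jacobian_minor_def
  proof (rule arg_cong[of _ _ det], rule eq_matI)
    fix i j assume "i < dim_row (mat n n (\<lambda>(i, j). jacobian_matrix n gs $$ (f i, g j)))"
      "j < dim_col (mat n n (\<lambda>(i, j). jacobian_matrix n gs $$ (f i, g j)))"
    then have "i < n" "j < n" by auto
    then show "mat n n (\<lambda>(i, j). mpoly_deriv (g j) (Q i)) $$ (i, j) =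
      mat n n (\<lambda>(i, j). jacobian_matrix n gs $$ (f i, g j)) $$ (i, j)"
      using f assms(1)[of j] by (simp add: jacobian_matrix_def)
  qed auto
  also have "\<dots> \<in> minors_ideal n n (jacobian_matrix n gs)"
    using f(1) assms(1)
    by (intro reindexed_minor_in_minors_ideal order_ge_carrier[OF jacobian_matrix_entries])
       (auto simp: jacobian_matrix_dims less_Suc_eq_le)
  finally show "jacobian_minor n g Q \<in> I" using minors_subset_I by auto
qed (use assms(2) in auto)

lemma bordered_jacobian_det_in_I:
  assumes "\<And>i. i < n \<Longrightarrow> Q i \<in> J"
  shows "det (bordered_jacobian Q l) \<in> I"
proof -
  let ?A = "bordered_jacobian Q l"
  have A: "?A \<in> carrier_mat (n + 1) (n + 1)" by (simp add: bordered_jacobian_def)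
  have "det ?A = (\<Sum>j<n + 1. ?A $$ (n, j) * cofactor ?A n j)"
    by (rule laplace_expansion_row[OF A]) simp
  also have "\<dots> \<in> I"
  proof (rule poly_ideal_sum[OF I_ideal])
    fix j assume "j \<in> {..<n + 1}"
    then have j: "j < n + 1" by simp
    define g where "g j' = (if j' < j then j' else Suc j')" for j'
    have "mat_delete ?A n j = mat n n (\<lambda>(i, j). mpoly_deriv (g j) (Q i))"
      by (rule eq_matI) (auto simp: mat_delete_def bordered_jacobian_def g_def)
    then have cof: "cofactor ?A n j = (- 1) ^ (n + j) * jacobian_minor n g Q"
      by (simp add: cofactor_def jacobian_minor_def)
    have minor: "jacobian_minor n g Q \<in> I"
      by (rule jacobian_minor_in_I) (auto simp: g_def assms)
    have sign: "(- 1) ^ k \<in> carrier (poly_ring n :: 'k mpoly ring)" for k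
      by (cases "even k") auto
    have entry: "?A $$ (n, j) \<in> carrier (poly_ring n)"
      using j form_space_carrier[OF form_space_const, of "l $ j" n] by (simp add: bordered_jacobian_def)
    show "?A $$ (n, j) * cofactor ?A n j \<in> I"
      unfolding cof by (intro poly_ideal_mult[OF I_ideal] entry sign minor)
  qed
  finally show ?thesis .
qed

text \<open>
  Interpolation: every form of degree \<open>n\<close> takes the same values at the points as a combination of the
  separating determinants, and a form that vanishes at the points is in \<open>J\<close>.
\<close>

lemma forms_in_I: "form_space n n \<subseteq> I"
proof
  fix f :: "'k mpoly" assume f: "f \<in> form_space n n"
  have "\<exists>D. D \<in> I \<inter> form_space n n \<and> mpoly_eval D (v q) \<noteq> 0 \<and> (\<forall>p\<in>P - {q}. mpoly_eval D (v p) = 0)"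
    if q: "q \<in> P" for q
  proof -
    obtain Q l where Q: "\<And>i. i < n \<Longrightarrow> Q i \<in> form_space n 2 \<inter> J"
      and D: "mpoly_eval (det (bordered_jacobian Q l)) (v q) \<noteq> 0"
      "\<forall>p\<in>P - {q}. mpoly_eval (det (bordered_jacobian Q l)) (v p) = 0"
      using separating_jacobian_determinant[OF q] by blast
    have "det (bordered_jacobian Q l) \<in> form_space n (\<Sum>i<n + 1. if i < n then 1 else 0)"
    proof (rule det_in_form_space)
      show "bordered_jacobian Q l \<in> carrier_mat (n + 1) (n + 1)" by (simp add: bordered_jacobian_def)
      fix i j assume "i < n + 1" "j < n + 1"
      then show "bordered_jacobian Q l $$ (i, j) \<in> form_space n (if i < n then 1 else 0)"
        using mpoly_deriv_form[of "Q i" n 1 j] Q[of i]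
        by (auto simp: bordered_jacobian_def form_space_const numeral_2_eq_2)
    qed
    then have "det (bordered_jacobian Q l) \<in> form_space n n" by simp
    moreover have "det (bordered_jacobian Q l) \<in> I"
      by (rule bordered_jacobian_det_in_I) (use Q in auto)
    ultimately show ?thesis using D by blast
  qed
  then have "\<forall>q\<in>P. \<exists>D. D \<in> I \<inter> form_space n n \<and> mpoly_eval D (v q) \<noteq> 0 \<and>
      (\<forall>p\<in>P - {q}. mpoly_eval D (v p) = 0)" by blast
  from bchoice[OF this] obtain D where D: "\<And>q. q \<in> P \<Longrightarrow> D q \<in> I" "\<And>q. q \<in> P \<Longrightarrow> D q \<in> form_space n n"
    "\<And>q. q \<in> P \<Longrightarrow> mpoly_eval (D q) (v q) \<noteq> 0"
    "\<And>q p. q \<in> P \<Longrightarrow> p \<in> P \<Longrightarrow> p \<noteq> q \<Longrightarrow> mpoly_eval (D q) (v p) = 0"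
    by auto
  define g where "g = (\<Sum>q\<in>P. Poly_Mapping.single 0 (mpoly_eval f (v q) / mpoly_eval (D q) (v q)) * D q)"
  have g_I: "g \<in> I"
    unfolding g_def
    by (intro poly_ideal_sum[OF I_ideal] poly_ideal_mult[OF I_ideal] D(1)
        form_space_carrier[OF form_space_const])
  have g_form: "g \<in> form_space n n"
    unfolding g_def by (intro form_space_sum form_space_smult D(2))
  have g_eval: "mpoly_eval g (v p) = mpoly_eval f (v p)" if p: "p \<in> P" for p
  proof -
    have "mpoly_eval g (v p) = (\<Sum>q\<in>P. if q = p then mpoly_eval f (v p) else 0)"
      unfolding g_def mpoly_eval_sum
      using D(3,4) p by (intro sum.cong) (auto simp: mpoly_eval_mult mpoly_eval_single)
    then show ?thesis using p finite_P by simp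
  qed
  have "mpoly_eval (f - g) (v p) = 0" if "p \<in> P" for p
  proof -
    interpret comm_ring_hom "\<lambda>f :: 'k mpoly. mpoly_eval f (v p)" by (rule mpoly_eval_hom)
    show ?thesis using g_eval[OF that] by (simp add: hom_minus)
  qed
  then have "f - g \<in> J" using form_in_J_iff[OF form_space_diff[OF f g_form]] by blast
  then have "(f - g) + g \<in> I" using J_subset_I g_I poly_ideal_add[OF I_ideal] by blast
  then show "f \<in> I" by simp
qed

abbreviation I_power :: "nat \<Rightarrow> 'k mpoly set" where
  "I_power t \<equiv> I [^]\<^bsub>ideals_set (poly_ring n)\<^esub> t"

text \<open>
  Multiply \<open>I\<^sup>t \<subseteq> J I\<^sup>t\<^sup>-\<^sup>1 + \<mm>\<^sup>n\<^sup>t\<close> by \<open>I = J + \<mm>\<^sup>n\<close>. Every product except \<open>\<mm>\<^sup>n\<^sup>t \<mm>\<^sup>n\<close> has a factor from \<open>J\<close>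
  and \<open>t\<close> further factors from \<open>I\<close>, because \<open>\<mm>\<^sup>n \<subseteq> I\<close>.
\<close>

lemma I_power_subset:
  "I_power (Suc t) \<subseteq> {a + b | a b. a \<in> ideal_prod (poly_ring n) J (I_power t) \<and> b \<in> order_ge n (n * Suc t)}"
proof (induction t)
  case 0
  let ?K = "{a + b | a b. a \<in> ideal_prod (poly_ring n) J (I_power 0) \<and> b \<in> order_ge n (n * Suc 0)}"
  have K: "ideal ?K (poly_ring n)"
    by (intro sum_of_ideals_ideal ideal_prod_poly_ring_ideal J_ideal order_ge_ideal ideals_set_pow_ideal I_ideal)
  show ?case unfolding ideals_set_pow_Suc[of _ _ 0]
  proof (rule ideal_prod_least[OF K])
    fix x y assume x: "x \<in> I_power 0" and "y \<in> I"
    then obtain a b where y: "y = a + b" "a \<in> J" "b \<in> order_ge n n" using I_subset by blast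
    have "x * y = a * x + x * b" by (simp add: y algebra_simps)
    moreover have "a * x \<in> ideal_prod (poly_ring n) J (I_power 0)"
      using ideal_prod_mult_mem[OF y(2) x] .
    moreover have "x * b \<in> order_ge n (n * Suc 0)"
      using poly_ideal_mult[OF order_ge_ideal _ y(3)] x by (simp add: ideals_set_pow_0)
    ultimately show "x * y \<in> ?K" by blast
  qed
next
  case (Suc t)
  let ?K = "{a + b | a b. a \<in> ideal_prod (poly_ring n) J (I_power (Suc t)) \<and> b \<in> order_ge n (n * Suc (Suc t))}"
  have JI: "ideal (ideal_prod (poly_ring n) J (I_power (Suc t))) (poly_ring n)"
    by (intro ideal_prod_poly_ring_ideal J_ideal ideals_set_pow_ideal I_ideal)
  then have K: "ideal ?K (poly_ring n)"
    by (intro sum_of_ideals_ideal order_ge_ideal)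
  show ?case unfolding ideals_set_pow_Suc[of _ _ "Suc t"]
  proof (rule ideal_prod_least[OF K])
    fix x y assume x: "x \<in> I_power (Suc t)" and "y \<in> I"
    then obtain a b where y: "y = a + b" "a \<in> J" "b \<in> order_ge n n" using I_subset by blast
    from x Suc obtain u w where u: "x = u + w" "u \<in> ideal_prod (poly_ring n) J (I_power t)"
      "w \<in> order_ge n (n * Suc t)" by blast
    have "b \<in> I" using y order_ge_power[OF I_ideal forms_in_I, of 1] J_subset_I \<open>y \<in> I\<close>
      poly_ideal_diff[OF I_ideal, of y a] by auto
    have "a * x \<in> ideal_prod (poly_ring n) J (I_power (Suc t))"
      using ideal_prod_mult_mem[OF y(2) x] .
    moreover have "b * u \<in> ideal_prod (poly_ring n) J (I_power (Suc t))"
    proof (rule ideal_prod_mult_right[OF u(2)])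
      fix g assume "g \<in> I_power t"
      from ideal_prod_mult_mem[OF this \<open>b \<in> I\<close>]
      show "b * g \<in> I_power (Suc t)" unfolding ideals_set_pow_Suc by (simp add: mult.commute)
    qed
    ultimately have 1: "a * x + b * u \<in> ideal_prod (poly_ring n) J (I_power (Suc t))"
      by (rule poly_ideal_add[OF JI])
    have 2: "w * b \<in> order_ge n (n * Suc (Suc t))"
      using order_ge_mult[OF u(3) y(3)] by (simp add: ac_simps)
    have "x * y = (a * x + b * u) + w * b" using u(1) y(1) by (simp add: algebra_simps)
    then show "x * y \<in> ?K" using 1 2 by blast
  qed
qed

theorem aluffi_torsion_free_jacobian: "aluffi_torsion_free (poly_ring n) J I"
  unfolding aluffi_torsion_free_def
proof (intro conjI allI impI)
  show "ideal J (poly_ring n)" "ideal I (poly_ring n)" "J \<subseteq> I"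
    by (rule J_ideal I_ideal J_subset_I)+
  fix t :: nat assume "2 \<le> t"
  then obtain s where t: "t = Suc s" by (cases t) auto
  have JI: "ideal (ideal_prod (poly_ring n) J (I_power s)) (poly_ring n)"
    by (intro ideal_prod_poly_ring_ideal J_ideal ideals_set_pow_ideal I_ideal)
  have "ideal_prod (poly_ring n) J (I_power s) \<subseteq> J"
    by (rule ideal_prod_least[OF J_ideal])
       (use poly_ideal_mult'[OF J_ideal] poly_ideal_carrier[OF ideals_set_pow_ideal[OF I_ideal]] in blast)
  moreover have "ideal_prod (poly_ring n) J (I_power s) \<subseteq> I_power (Suc s)"
  proof (rule ideal_prod_least[OF ideals_set_pow_ideal[OF I_ideal]])
    fix f g assume "f \<in> J" "g \<in> I_power s"
    then show "f * g \<in> I_power (Suc s)"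
      using ideal_prod_mult_mem[of g "I_power s" f I n] J_subset_I
      unfolding ideals_set_pow_Suc by (auto simp: mult.commute)
  qed
  moreover have "J \<inter> I_power (Suc s) \<subseteq> ideal_prod (poly_ring n) J (I_power s)"
  proof
    fix f assume f: "f \<in> J \<inter> I_power (Suc s)"
    then obtain a b where ab: "f = a + b" "a \<in> ideal_prod (poly_ring n) J (I_power s)"
      "b \<in> order_ge n (n * Suc s)" using I_power_subset by blast
    have "a \<in> J" using ab calculation(1) by blast
    then have "b \<in> J" using ab(1) f poly_ideal_diff[OF J_ideal, of f a] by auto
    then have "b \<in> ideal_prod (poly_ring n) J (order_ge n (n * s))"
      using ab(3) J_order_ge_subset[of "n * s"] by auto
    then have "b \<in> ideal_prod (poly_ring n) J (I_power s)"
      using ideal_prod_mono_right[OF order_ge_power[OF I_ideal forms_in_I, of s]] by blast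
    then show "f \<in> ideal_prod (poly_ring n) J (I_power s)"
      unfolding ab(1) using ab(2) poly_ideal_add[OF JI] by blast
  qed
  ultimately show "J \<inter> I_power t = ideal_prod (poly_ring n) J (I_power (t - 1))"
    by (auto simp: t)
qed

end

end

section \<open>Points of projective space\<close>

lemma proj_space_point:
  fixes p :: "'k::field vec set"
  assumes "p \<in> proj_space n" "w \<in> p"
  shows "w \<in> carrier_vec (n + 1)" "x \<in> p \<longleftrightarrow> (\<exists>c. c \<noteq> 0 \<and> x = c \<cdot>\<^sub>v w)"
proof -
  obtain u where u: "u \<in> carrier_vec (n + 1)" "u \<noteq> 0\<^sub>v (n + 1)" "p = proj_rel n `` {u}"
    using assms(1) by (auto simp: proj_space_def quotient_def)
  have smult_0: "c = 0" if "c \<cdot>\<^sub>v u = 0\<^sub>v (n + 1)" for c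
  proof (rule ccontr)
    assume "c \<noteq> 0"
    have "u = inverse c \<cdot>\<^sub>v (c \<cdot>\<^sub>v u)" using \<open>c \<noteq> 0\<close> by (simp add: smult_smult_assoc)
    also have "\<dots> = 0\<^sub>v (n + 1)" unfolding that by (rule eq_vecI) auto
    finally show False using u(2) by simp
  qed
  have p: "p = {c \<cdot>\<^sub>v u | c. c \<noteq> 0}"
    using u smult_0 by (auto simp: proj_rel_def)
  then obtain c0 where c0: "c0 \<noteq> 0" "w = c0 \<cdot>\<^sub>v u" using assms(2) by auto
  show "w \<in> carrier_vec (n + 1)" using u(1) c0 by simp
  show "x \<in> p \<longleftrightarrow> (\<exists>c. c \<noteq> 0 \<and> x = c \<cdot>\<^sub>v w)"
  proof
    assume "x \<in> p"
    then obtain c where "c \<noteq> 0" "x = c \<cdot>\<^sub>v u" using p by auto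
    then have "x = (c / c0) \<cdot>\<^sub>v w" "c / c0 \<noteq> 0" using c0 by (simp_all add: smult_smult_assoc)
    then show "\<exists>c. c \<noteq> 0 \<and> x = c \<cdot>\<^sub>v w" by blast
  next
    assume "\<exists>c. c \<noteq> 0 \<and> x = c \<cdot>\<^sub>v w"
    then obtain c where "c \<noteq> 0" "x = c \<cdot>\<^sub>v w" by auto
    then have "x = (c * c0) \<cdot>\<^sub>v u" "c * c0 \<noteq> 0" using c0 by (simp_all add: smult_smult_assoc)
    then show "x \<in> p" unfolding p by blast
  qed
qed

lemma proj_space_nonempty: "p \<in> proj_space n \<Longrightarrow> \<exists>w. w \<in> (p :: 'k::field vec set)"
  unfolding proj_space_def proj_rel_def quotient_def
  by (auto intro!: exI[of _ "1::'k"])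

definition representative :: "'k vec set \<Rightarrow> 'k vec" where
  "representative p = (SOME w. w \<in> p)"

lemma representative_in: "p \<in> proj_space n \<Longrightarrow> representative p \<in> (p :: 'k::field vec set)"
  unfolding representative_def using proj_space_nonempty[of p n] by (rule someI_ex)

lemma general_points_of_general_linear_position:
  fixes \<Gamma> :: "'k::alg_closed_field vec set set"
  assumes n: "4 \<le> n" and \<Gamma>: "\<Gamma> \<subseteq> proj_space n" "card \<Gamma> = n + 3" "general_linear_position n \<Gamma>"
  shows "general_points n \<Gamma> representative"
proof
  show "infinite (UNIV :: 'k set)" by (rule infinite_UNIV_alg_closed)
  show "4 \<le> n" "card \<Gamma> = n + 3" by fact+
  fix p assume "p \<in> \<Gamma>"
  then show "representative p \<in> carrier_vec (n + 1)"
    using proj_space_point(1) representative_in \<Gamma>(1) by blast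
next
  fix T and a :: "'k vec"
  assume T: "T \<subseteq> \<Gamma>" "card T = n + 1" and a: "a \<in> carrier_vec (n + 1)"
    and van: "\<And>p. p \<in> T \<Longrightarrow> a \<bullet> representative p = 0"
  show "a = 0\<^sub>v (n + 1)"
  proof (rule ccontr)
    assume "a \<noteq> 0\<^sub>v (n + 1)"
    let ?H = "{p \<in> proj_space n. \<forall>v \<in> p. a \<bullet> v = 0}"
    have "is_hyperplane n ?H" unfolding is_hyperplane_def using a \<open>a \<noteq> 0\<^sub>v (n + 1)\<close> by blast
    moreover have "T \<subseteq> ?H"
    proof
      fix p assume p: "p \<in> T"
      then have pp: "p \<in> proj_space n" using T \<Gamma> by blast
      have "a \<bullet> (c \<cdot>\<^sub>v representative p) = 0" for c
        using van[OF p] a proj_space_point(1)[OF pp representative_in[OF pp]] by simp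
      moreover have "\<exists>c. v = c \<cdot>\<^sub>v representative p" if "v \<in> p" for v
        using proj_space_point(2)[OF pp representative_in[OF pp]] that by auto
      ultimately have "\<forall>v\<in>p. a \<bullet> v = 0" by metis
      then show "p \<in> ?H" using pp by simp
    qed
    ultimately show False using \<Gamma>(2,3) T unfolding general_linear_position_def by auto
  qed
qed

text \<open>
  A polynomial in the ideal of a point vanishes on the whole punctured line over that point. Conversely,
  the homogeneous parts of an element of \<open>J\<close> are themselves in \<open>J\<close>, so they are generators of the ideal
  of each point.
\<close>

lemma defining_ideal_eq_J:
  fixes P :: "'k::field vec set set"
  assumes "general_points n P v" "P \<subseteq> proj_space n" "\<And>p. p \<in> P \<Longrightarrow> v p \<in> p"
  shows "defining_ideal n P = general_points.J n P v"
proof -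
  interpret general_points n P v by fact
  have pt: "w \<in> p \<longleftrightarrow> (\<exists>c. c \<noteq> 0 \<and> w = c \<cdot>\<^sub>v v p)" if "p \<in> P" for p w
    using proj_space_point(2)[of p n "v p"] assms(2,3) that by blast
  let ?G = "\<lambda>p. {f \<in> carrier (poly_ring n). homogeneous f \<and> (\<forall>v \<in> p. mpoly_eval f v = 0)}"
  show ?thesis
  proof (intro equalityI subsetI)
    fix f assume f: "f \<in> defining_ideal n P"
    then have car: "f \<in> carrier (poly_ring n)" by (simp add: defining_ideal_def)
    have "mpoly_eval f (c \<cdot>\<^sub>v v p) = 0" if p: "p \<in> P" and c: "c \<noteq> 0" for p c
    proof -
      have "ideal {f \<in> carrier (poly_ring n). \<forall>v\<in>p. mpoly_eval f v = 0} (poly_ring n)"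
        by (rule ideal_poly_ringI) (auto simp: mpoly_eval_add mpoly_eval_mult)
      then have "point_ideal n p \<subseteq> {f \<in> carrier (poly_ring n). \<forall>v\<in>p. mpoly_eval f v = 0}"
        unfolding point_ideal_def by (rule genideal_poly_ring_minimal) auto
      then show ?thesis using f p c pt[OF p] by (auto simp: defining_ideal_def)
    qed
    then show "f \<in> J" using car by (simp add: J_def)
  next
    fix f assume f: "f \<in> J"
    then have car: "f \<in> carrier (poly_ring n)" by (simp add: J_def)
    have "f \<in> point_ideal n p" if p: "p \<in> P" for p
    proof -
      have ideal: "ideal (point_ideal n p) (poly_ring n)"
        unfolding point_ideal_def by (rule genideal_poly_ring_ideal) auto
      have "form_part d f \<in> ?G p" for d
      proof -
        have "homogeneous (form_part d f)"
          using form_part_in[OF car, of d] by (auto simp: homogeneous_def form_space_def monomial_degree_def)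
        moreover have "mpoly_eval (form_part d f) w = 0" if w: "w \<in> p" for w
        proof -
          obtain c where "c \<noteq> 0" "w = c \<cdot>\<^sub>v v p" using iffD1[OF pt[OF p] w] by auto
          then show ?thesis using form_part_in_J[OF f, of d] p by (auto simp: J_def)
        qed
        ultimately show ?thesis using form_space_carrier[OF form_part_in[OF car]] by blast
      qed
      moreover have "?G p \<subseteq> point_ideal n p"
        unfolding point_ideal_def by (rule genideal_poly_ring_self) auto
      ultimately have "(\<Sum>d\<in>monomial_degree ` Poly_Mapping.keys f. form_part d f) \<in> point_ideal n p"
        by (intro poly_ideal_sum[OF ideal]) blast
      then show ?thesis by (simp only: poly_as_sum_of_forms[symmetric])
    qed
    then show "f \<in> defining_ideal n P" using car by (auto simp: defining_ideal_def)
  qed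
qed

theorem proposition4p5:
  fixes n :: nat
    and \<Gamma> :: "'k::alg_closed_field vec set set"
    and gs :: "'k mpoly list"
  assumes "n \<ge> 4"
    and "\<Gamma> \<subseteq> proj_space n"
    and "card \<Gamma> = n + 3"
    and "general_linear_position n \<Gamma>"
    and "minimal_homogeneous_generators n (defining_ideal n \<Gamma>) gs"
  shows "aluffi_torsion_free (poly_ring n) (defining_ideal n \<Gamma>) (jacobian_ideal n gs)"
proof -
  interpret general_points n \<Gamma> representative
    using assms(1-4) by (rule general_points_of_general_linear_position)
  have J: "defining_ideal n \<Gamma> = J"
    using assms(2) representative_in general_points_axioms by (intro defining_ideal_eq_J) blast+
  show ?thesis
    unfolding J
    by (rule aluffi_torsion_free_jacobian)
       (use assms(5) in \<open>auto simp: minimal_homogeneous_generators_def J\<close>)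
qed

end
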